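(* Let $(\lambda_n)_{n\ge 0}$ be positive numbers satisfying the following hypotheses: \begin{enumerate} \item[(i)] $\sum_n \frac{1}{\lambda_n} = +\infty$; \item[(ii)] there exists $C>1$ such that for all $n\ge 1$, \[ C^{-1}\lambda_n \le \lambda_k \le C\lambda_n, \qquad n\le k\le 2n . \] \end{enumerate} Then there exists a function $f\in L^\infty(\mathbb{T},dm)$ with $f\ge 0$ $dm$-a.e. and $f$ not $dm$-a.e. equal to $0$, such that $\operatorname{supp}(f\,dm)$ has empty interior in $\mathbb{T}$, but \[ \sum_{n\in\mathbb{Z}} |\widehat{f}(n)|^2 \lambda_{|n|} < \infty . \]
   Context: $\mathbb{T}$ is the unit circle in $\mathbb{C}$, $dm$ is arc-length measure on $\mathbb{T}$ normalized so that $m(\mathbb{T})=1$, and $\widehat{f}(n)=\int_{\mathbb{T}} f(\zeta)\overline{\zeta}^{\,n}\,dm(\zeta)$, $n\in\mathbb{Z}$. $\operatorname{supp}(f\,dm)$ is the closed support of the measure $f\,dm$, i.e. the complement of the largest open subset of $\mathbb{T}$ on which $f=0$ $dm$-a.e. *)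

theory Defs
  imports "HOL-Analysis.Analysis"
begin

abbreviation unit_circle :: "complex set" where
  "unit_circle \<equiv> sphere 0 1"

text \<open>
  Normalized arc-length measure: \<open>cis\<close> is the arc-length parametrization of the circle, so this is
  the image of Lebesgue measure on \<open>[0, 2\<pi>)\<close> divided by \<open>2\<pi>\<close>. Its sigma-algebra is the Borel
  sigma-algebra of the circle.
\<close>

definition circle_measure :: "complex measure" where
  "circle_measure =
     distr (uniform_measure lborel {0..<2 * pi}) (restrict_space borel unit_circle) cis"

lemma space_circle_measure [simp]: "space circle_measure = unit_circle"
  by (simp add: circle_measure_def space_restrict_space)

lemma sets_circle_measure [simp, measurable_cong]:
  "sets circle_measure = sets (restrict_space borel unit_circle)"
  by (simp add: circle_measure_def)

lemma measurable_cis_circle: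
  "cis \<in> measurable (uniform_measure lborel A) (restrict_space borel unit_circle)"
proof (rule measurable_restrict_space2)
  show "cis \<in> space (uniform_measure lborel A) \<rightarrow> unit_circle"
    by simp
  have "cis \<in> borel_measurable borel"
    by (intro borel_measurable_continuous_onI continuous_intros)
  then show "cis \<in> borel_measurable (uniform_measure lborel A)"
    by (simp add: measurable_def)
qed

lemma emeasure_circle_measure_space: "emeasure circle_measure unit_circle = 1"
proof -
  have *: "unit_circle \<in> sets (restrict_space borel unit_circle)"
    by (metis sets.top space_circle_measure sets_circle_measure)
  have "cis -` unit_circle = UNIV"
    by auto
  then show ?thesis
    unfolding circle_measure_def emeasure_distr[OF measurable_cis_circle *]
    by (simp add: ennreal_divide_self)
qed

definition fourier_coeff :: "(complex \<Rightarrow> complex) \<Rightarrow> int \<Rightarrow> complex" where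
  "fourier_coeff f n = (LINT z|circle_measure. f z * cnj z powi n)"

definition Linfty :: "'a measure \<Rightarrow> ('a \<Rightarrow> complex) set" where
  "Linfty M = {f \<in> borel_measurable M. \<exists>B. AE z in M. norm (f z) \<le> B}"

text \<open>
  Closed support of the measure with density \<open>f\<close> with respect to \<^const>\<open>circle_measure\<close>. The union
  below is the largest relatively open subset of the circle on which \<open>f\<close> vanishes almost everywhere,
  because the circle is second countable (\<open>AE_zero_off_circle_support\<close>).
\<close>

definition circle_support :: "(complex \<Rightarrow> complex) \<Rightarrow> complex set" where
  "circle_support f = unit_circle -
     \<Union>{U. openin (top_of_set unit_circle) U \<and> (AE z in circle_measure. z \<in> U \<longrightarrow> f z = 0)}"

lemma AE_zero_off_circle_support:
  "AE z in circle_measure. z \<in> unit_circle - circle_support f \<longrightarrow> f z = 0"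
proof -
  let ?F = "{U. openin (top_of_set unit_circle) U \<and> (AE z in circle_measure. z \<in> U \<longrightarrow> f z = 0)}"
  obtain G where G: "G \<subseteq> ?F" "countable G" "\<Union>G = \<Union>?F"
    using Lindelof_openin[of ?F unit_circle] by blast
  have "AE z in circle_measure. \<forall>U\<in>G. z \<in> U \<longrightarrow> f z = 0"
    using G by (subst AE_ball_countable) auto
  then show ?thesis
  proof eventually_elim
    case (elim z)
    then have "z \<in> \<Union>G \<longrightarrow> f z = 0"
      by blast
    then show ?case
      unfolding G(3) circle_support_def by blast
  qed
qed

end

theory Submission
  imports Defs
begin

text \<open>
  Because \<open>\<Sum>1/\<lambda>\<^sub>n\<close> diverges and \<open>\<lambda>\<close> is doubling, \<open>\<Sum> 2\<^sup>j/\<lambda>(2\<^sup>j)\<close> diverges, so a single point has zero capacity: an average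
  \<open>\<Sum> \<alpha>\<^sub>j \<psi>\<^sub>j\<close> of bumps \<open>\<psi>\<^sub>j\<close> at the scales \<open>q\<^sup>-\<^sup>j\<close>, with \<open>\<psi>\<^sub>j = 1\<close> near the point and \<open>\<alpha>\<^sub>j\<close> roughly proportional
  to \<open>q\<^sup>j/\<lambda>(q\<^sup>j)\<close>, has arbitrarily small weighted norm and is still \<open>1\<close> near the point. As \<open>\<lambda>\<close> may oscillate
  wildly between the scales, the bumps must be smooth and have many vanishing moments. This is achieved,
  keeping \<open>\<bar>\<psi>\<^sub>j\<bar> \<le> 1\<close>, by iterated averages followed by iterated differences of translates with disjoint supports.
  The resulting function \<open>H\<close> satisfies \<open>0 \<le> H \<le> 1\<close>, and \<open>1 - H\<close> multiplies the weighted space boundedly. Hence the product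
  of \<open>1 - H\<^sub>k\<close>, with \<open>H\<^sub>k\<close> centred at the points of a dense sequence and chosen one after another with rapidly decreasing
  norms, converges to the desired function.
\<close>

section \<open>Integration and Fourier coefficients on the circle\<close>

text \<open>Two demands conflict. The norm estimate uses bumps with coefficients small on both sides
  of their own frequency band, so in particular bumps of mean zero; but a mean-zero bump that is 1
  near a point is negative elsewhere, while \<open>H\<close> must lie in [0,1]. The negativity is
  made harmless instead of avoided: q is so large that each support lies in the previous plateau,
  every coefficient \<alpha>_j is at most the reciprocal of a huge sum, and adding an equally small
  constant restores positivity. The two-sided decay makes the scales almost orthogonal: the squared
  norm of the average is at most of order \<Sum> \<alpha>_j^2 \<lambda>(q^j)/q^j. The exponent
  \<open>a + 2\<close> recurs because doubling lets the weight change by at most a polynomial factor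
  of order a under frequency shifts, and two further powers leave a convergent sum. The multiplier
  bound of a partial product is known only to be finite, so each tolerance is fixed after the
  preceding product. The limit is nonzero because its mean stays close to 1.\<close>

lemma finite_measure_circle: "finite_measure circle_measure"
  by (rule finite_measureI) (simp add: emeasure_circle_measure_space)

lemma measure_circle [simp]: "measure circle_measure unit_circle = 1"
  by (simp add: measure_def emeasure_circle_measure_space)

lemma borel_measurable_circle_continuous:
  fixes f :: "complex \<Rightarrow> 'b::topological_space"
  assumes "continuous_on unit_circle f"
  shows "f \<in> borel_measurable circle_measure"
proof -
  have "f \<in> borel_measurable (restrict_space borel unit_circle)"
    using assms by (rule borel_measurable_continuous_on_restrict)
  then show ?thesis by (simp cong: measurable_cong_sets)
qed

lemma AE_circle_space: "(\<And>z. z \<in> unit_circle \<Longrightarrow> P z) \<Longrightarrow> AE z in circle_measure. P z"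
  by (rule AE_I2) simp

lemma integrable_circle_bounded:
  fixes f :: "complex \<Rightarrow> 'b::{banach, second_countable_topology}"
  assumes "f \<in> borel_measurable circle_measure" "\<And>z. z \<in> unit_circle \<Longrightarrow> norm (f z) \<le> B"
  shows "integrable circle_measure f"
  by (rule finite_measure.integrable_const_bound[OF finite_measure_circle, where B=B])
     (use assms in \<open>auto intro: AE_circle_space\<close>)

lemma continuous_on_circle_bounded:
  fixes f :: "complex \<Rightarrow> 'b::real_normed_vector"
  assumes "continuous_on unit_circle f"
  obtains B where "B > 0" "\<And>z. z \<in> unit_circle \<Longrightarrow> norm (f z) \<le> B"
proof -
  have "compact (f ` unit_circle)"
    by (rule compact_continuous_image[OF assms compact_sphere])
  then show thesis
    using that compact_imp_bounded bounded_pos by (metis imageI)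
qed

lemma integrable_circle_continuous:
  fixes f :: "complex \<Rightarrow> 'b::{banach, second_countable_topology}"
  assumes "continuous_on unit_circle f"
  shows "integrable circle_measure f"
proof -
  obtain B where "\<And>z. z \<in> unit_circle \<Longrightarrow> norm (f z) \<le> B"
    using continuous_on_circle_bounded[OF assms] by blast
  then show ?thesis
    by (intro integrable_circle_bounded[where B=B] borel_measurable_circle_continuous assms)
qed

lemma norm_integral_circle_le:
  fixes f :: "complex \<Rightarrow> 'b::{banach, second_countable_topology}"
  assumes "\<And>z. z \<in> unit_circle \<Longrightarrow> norm (f z) \<le> B" "B \<ge> 0"
  shows "norm (LINT z|circle_measure. f z) \<le> B"
proof (cases "integrable circle_measure f")
  case True
  interpret finite_measure circle_measure by (rule finite_measure_circle)
  have "norm (LINT z|circle_measure. f z) \<le> (LINT z|circle_measure. norm (f z))"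
    by (rule integral_norm_bound)
  also have "\<dots> \<le> (LINT z|circle_measure. B)"
    by (rule integral_mono_AE) (use True assms in \<open>auto intro!: AE_circle_space\<close>)
  finally show ?thesis by simp
\<comment> \<open>Without integrability the Bochner integral is 0 by convention, and then
  \<open>B \<ge> 0\<close> suffices.\<close>
qed (use assms in \<open>auto simp: not_integrable_integral_eq\<close>)

lemma circle_integral_eq:
  fixes f :: "complex \<Rightarrow> complex"
  assumes "continuous_on unit_circle f"
  shows "(LINT z|circle_measure. f z) = integral {0..2*pi} (\<lambda>x. f (cis x)) / (2 * pi)"
proof -
  have cont: "continuous_on A (\<lambda>x. f (cis x))" for A
    by (intro continuous_on_compose2[OF assms]) (auto intro!: continuous_intros)
  have m: "(\<lambda>x. f (cis x)) \<in> borel_measurable borel"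
    using cont by (rule borel_measurable_continuous_onI)
  have "(LINT z|circle_measure. f z) = (LINT x|uniform_measure lborel {0..<2*pi}. f (cis x))"
    unfolding circle_measure_def
    by (rule integral_distr[OF measurable_cis_circle])
       (rule borel_measurable_continuous_on_restrict[OF assms])
  also have "uniform_measure lborel {0..<2*pi} =
      density lborel (\<lambda>x. ennreal (indicator {0..<2*pi} x / (2 * pi)))"
    unfolding uniform_measure_def
    by (intro arg_cong2[where f=density] refl ext)
       (auto simp: indicator_def divide_ennreal simp flip: ennreal_1)
  also have "(LINT x|\<dots>. f (cis x)) = (LINT x|lborel. (indicator {0..<2*pi} x / (2 * pi)) *\<^sub>R f (cis x))"
    by (rule integral_density) (use m in auto)
  \<comment> \<open>Passing from the half-open to the closed interval changes the integrand only at
    the null point \<open>2 * pi\<close>.\<close>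
  also have "\<dots> = (LINT x|lborel. (1 / (2 * pi)) *\<^sub>R (indicator {0..2*pi} x *\<^sub>R f (cis x)))"
    by (rule integral_cong_AE)
       (use m AE_lborel_singleton[of "2 * pi"] in \<open>auto simp: indicator_def\<close>)
  also have "\<dots> = (1 / (2 * pi)) *\<^sub>R (LINT x:{0..2*pi}|lborel. f (cis x))"
    unfolding set_lebesgue_integral_def by (rule integral_scaleR_right)
  also have "(LINT x:{0..2*pi}|lborel. f (cis x)) = integral {0..2*pi} (\<lambda>x. f (cis x))"
    by (rule set_borel_integral_eq_integral) (rule borel_integrable_atLeastAtMost'[OF cont])
  finally show ?thesis by (simp add: scaleR_conv_of_real)
qed

lemma continuous_on_circle_rotate:
  fixes f :: "complex \<Rightarrow> 'b::topological_space"
  assumes "continuous_on unit_circle f"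
  shows "continuous_on unit_circle (\<lambda>z. f (z * cis t))"
  by (rule continuous_on_compose2[OF assms]) (auto intro!: continuous_intros simp: norm_mult)

text \<open>Rotation is translation of a periodic integrand. After the angle is reduced modulo
  \<open>2 * pi\<close>, the piece sticking out beyond \<open>2 * pi\<close> is wrapped back to the
  start of the interval.\<close>

lemma circle_integral_rotate:
  fixes f :: "complex \<Rightarrow> complex"
  assumes "continuous_on unit_circle f"
  shows "(LINT z|circle_measure. f (z * cis t)) = (LINT z|circle_measure. f z)"
proof -
  define g where "g = (\<lambda>x. f (cis x))"
  have cont: "continuous_on A g" for A
    unfolding g_def
    by (intro continuous_on_compose2[OF assms]) (auto intro!: continuous_intros)
  have int: "g integrable_on {a..b}" for a b
    by (rule integrable_continuous_real[OF cont])
  have per: "g (x + 2 * pi * of_int k) = g x" for x k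
    unfolding g_def cis_mult[symmetric] using cis_multiple_2pi[of "of_int k"] by simp
  have shift: "integral {a..b} (\<lambda>x. g (x + c)) = integral {a+c..b+c} g" for a b c
    using integral_shift_Icc_real[of a b g c] by (simp add: o_def add.commute)
  define k where "k = \<lfloor>t / (2 * pi)\<rfloor>"
  define s where "s = t - 2 * pi * of_int k"
  have s: "0 \<le> s" "s \<le> 2 * pi"
  proof -
    have "of_int k \<le> t / (2 * pi)" "t / (2 * pi) \<le> of_int k + 1"
      unfolding k_def by linarith+
    then show "0 \<le> s" "s \<le> 2 * pi"
      unfolding s_def by (simp_all add: field_simps)
  qed
  have "integral {0..2*pi} (\<lambda>x. g (x + t)) = integral {0..2*pi} (\<lambda>x. g (x + s))"
    using per[of "_ + s" k] by (simp add: s_def)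
  also have "\<dots> = integral {s..2*pi+s} g"
    by (simp add: shift)
  also have "\<dots> = integral {s..2*pi} g + integral {2*pi..2*pi+s} g"
    using s by (intro Henstock_Kurzweil_Integration.integral_combine[symmetric] int) auto
  also have "integral {2*pi..2*pi+s} g = integral {0..s} g"
    using shift[of 0 s "2 * pi"] per[of _ 1] by (simp add: add.commute)
  also have "integral {s..2*pi} g + integral {0..s} g = integral {0..2*pi} g"
    using s by (subst add.commute, intro Henstock_Kurzweil_Integration.integral_combine int) auto
  finally show ?thesis
    using assms continuous_on_circle_rotate[OF assms, of t]
    by (simp add: circle_integral_eq cis_mult g_def)
qed

lemma cnj_powi_circle:
  assumes "z \<in> unit_circle"
  shows "cnj z powi n = z powi (- n)"
proof -
  have "cnj z = inverse z"
    using assms complex_norm_square[of z]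
    by (metis dist_0_norm inverse_unique mem_sphere mult.commute of_real_1 power_one)
  then show ?thesis by (simp add: power_int_minus power_int_inverse)
qed

lemma continuous_on_circle_cnj_powi [continuous_intros]:
  "continuous_on unit_circle (\<lambda>z. cnj z powi n)"
  by (intro continuous_intros) auto

lemma fourier_coeff_add:
  assumes "continuous_on unit_circle f" "continuous_on unit_circle g"
  shows "fourier_coeff (\<lambda>z. f z + g z) n = fourier_coeff f n + fourier_coeff g n"
  unfolding fourier_coeff_def ring_distribs
  by (intro Bochner_Integration.integral_add integrable_circle_continuous continuous_intros assms)

lemma fourier_coeff_diff:
  assumes "continuous_on unit_circle f" "continuous_on unit_circle g"
  shows "fourier_coeff (\<lambda>z. f z - g z) n = fourier_coeff f n - fourier_coeff g n"
  unfolding fourier_coeff_def ring_distribs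
  by (intro Bochner_Integration.integral_diff integrable_circle_continuous continuous_intros assms)

lemma fourier_coeff_cmult: "fourier_coeff (\<lambda>z. c * f z) n = c * fourier_coeff f n"
  unfolding fourier_coeff_def mult.assoc by simp

lemma fourier_coeff_sum:
  assumes "\<And>i. i \<in> I \<Longrightarrow> continuous_on unit_circle (f i)"
  shows "fourier_coeff (\<lambda>z. \<Sum>i\<in>I. f i z) n = (\<Sum>i\<in>I. fourier_coeff (f i) n)"
  unfolding fourier_coeff_def sum_distrib_right
  by (intro Bochner_Integration.integral_sum integrable_circle_continuous continuous_intros assms)

lemma norm_fourier_coeff_le:
  assumes "\<And>z. z \<in> unit_circle \<Longrightarrow> norm (f z) \<le> B" "B \<ge> 0"
  shows "norm (fourier_coeff f n) \<le> B"
  unfolding fourier_coeff_def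
  by (rule norm_integral_circle_le) (use assms in \<open>auto simp: norm_mult norm_power_int\<close>)

lemma fourier_coeff_cong:
  assumes "\<And>z. z \<in> unit_circle \<Longrightarrow> f z = g z"
  shows "fourier_coeff f n = fourier_coeff g n"
  unfolding fourier_coeff_def
  by (rule Bochner_Integration.integral_cong) (use assms in auto)

lemma fourier_coeff_rotate:
  assumes "continuous_on unit_circle f"
  shows "fourier_coeff (\<lambda>z. f (z * cis t)) n = cis (of_int n * t) * fourier_coeff f n"
proof -
  define g where "g = (\<lambda>z. f z * cnj z powi n)"
  have "fourier_coeff (\<lambda>z. f (z * cis t)) n = (LINT z|circle_measure. cis (of_int n * t) * g (z * cis t))"
    unfolding fourier_coeff_def
  proof (rule Bochner_Integration.integral_cong)
    fix z assume "z \<in> space circle_measure"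
    have "cis (of_int n * t) * cnj (cis t) powi n = 1"
      by (simp add: cis_cnj cis_power_int cis_mult algebra_simps)
    then show "f (z * cis t) * cnj z powi n = cis (of_int n * t) * g (z * cis t)"
      by (simp add: g_def power_int_mult_distrib)
  qed auto
  also have "\<dots> = cis (of_int n * t) * (LINT z|circle_measure. g (z * cis t))"
    by simp
  also have "(LINT z|circle_measure. g (z * cis t)) = (LINT z|circle_measure. g z)"
    by (rule circle_integral_rotate) (auto simp: g_def intro!: continuous_intros assms)
  finally show ?thesis by (simp add: g_def fourier_coeff_def)
qed

text \<open>Orthogonality without evaluating an integral: rotation by \<open>pi / (m - n)\<close>
  multiplies \<open>z powi (m - n)\<close> by -1, yet leaves its integral unchanged.\<close>

lemma fourier_coeff_powi: "fourier_coeff (\<lambda>z. z powi m) n = (if m = n then 1 else 0)"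
proof -
  have *: "fourier_coeff (\<lambda>z. z powi m) n = (LINT z|circle_measure. z powi (m - n))"
    unfolding fourier_coeff_def
  proof (rule Bochner_Integration.integral_cong)
    fix z assume "z \<in> space circle_measure"
    then have z: "z \<in> unit_circle" by simp
    then have "z \<noteq> 0" by auto
    then show "z powi m * cnj z powi n = z powi (m - n)"
      using power_int_add[of z m "-n"] cnj_powi_circle[OF z] by simp
  qed auto
  show ?thesis
  proof (cases "m = n")
    case False
    have c: "continuous_on unit_circle (\<lambda>z. z powi (m - n))"
      by (intro continuous_intros) auto
    define t where "t = pi / of_int (m - n)"
    have t: "cis t powi (m - n) = -1"
      using False by (simp add: cis_power_int t_def)
    have "(LINT z|circle_measure. z powi (m - n)) = (LINT z|circle_measure. (z * cis t) powi (m - n))"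
      using circle_integral_rotate[OF c, of t] by simp
    also have "\<dots> = - (LINT z|circle_measure. z powi (m - n))"
      by (simp add: power_int_mult_distrib t)
    finally show ?thesis using False * by simp
  next
    case True
    have "(LINT z|circle_measure. 1 :: complex) = 1"
      using finite_measure.finite_emeasure_space[OF finite_measure_circle] by simp
    then show ?thesis using True * by simp
  qed
qed

lemma fourier_coeff_mult_powi:
  "fourier_coeff (\<lambda>z. z powi l * f z) n = fourier_coeff f (n - l)"
  unfolding fourier_coeff_def
proof (rule Bochner_Integration.integral_cong)
  fix z assume "z \<in> space circle_measure"
  then have z: "z \<in> unit_circle" by simp
  then have "z \<noteq> 0" by auto
  then show "z powi l * f z * cnj z powi n = f z * cnj z powi (n - l)"
    using power_int_add[of z l "-n"] cnj_powi_circle[OF z] by simp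
qed auto

lemma fourier_coeff_const: "fourier_coeff (\<lambda>z. c) n = (if n = 0 then c else 0)"
  using fourier_coeff_cmult[of c "\<lambda>z. z powi 0" n] fourier_coeff_powi[of 0 n] by auto

text \<open>Dominated convergence with a constant majorant. Convergence is only pointwise, because
  the function finally constructed is a decreasing limit that may be discontinuous.\<close>

lemma fourier_coeff_tendsto:
  assumes f: "\<And>k::nat. continuous_on unit_circle (f k)"
    and b: "\<And>k z. z \<in> unit_circle \<Longrightarrow> norm (f k z) \<le> B"
    and lim: "\<And>z. z \<in> unit_circle \<Longrightarrow> (\<lambda>k. f k z) \<longlonglongrightarrow> g z"
  shows "(\<lambda>k. fourier_coeff (f k) n) \<longlonglongrightarrow> fourier_coeff g n"
proof -
  interpret finite_measure circle_measure by (rule finite_measure_circle)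
  have m: "(\<lambda>z. f k z * cnj z powi n) \<in> borel_measurable circle_measure" for k
    by (intro borel_measurable_circle_continuous continuous_intros f)
  have l: "(\<lambda>k. f k z * cnj z powi n) \<longlonglongrightarrow> g z * cnj z powi n" if "z \<in> unit_circle" for z
    by (intro tendsto_intros lim that)
  show ?thesis
    unfolding fourier_coeff_def
  proof (rule integral_dominated_convergence[where w="\<lambda>_. B"])
    show "(\<lambda>z. g z * cnj z powi n) \<in> borel_measurable circle_measure"
      by (rule borel_measurable_LIMSEQ_metric[OF m l]) auto
  qed (use m l b in \<open>auto intro!: AE_circle_space simp: norm_mult norm_power_int\<close>)
qed

section \<open>Uniqueness and convergence of Fourier series\<close>

text \<open>On the circle a polynomial in Re z and Im z is a trigonometric polynomial, so
  multiplying by it only combines shifted coefficients. The induction keeps \<open>D\<close>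
  arbitrary: in the product case the second hypothesis is applied to \<open>D\<close> times the
  first factor.\<close>

lemma fourier_coeff_mult_real_polynomial:
  assumes "real_polynomial_function q" "continuous_on unit_circle D" "\<And>n. fourier_coeff D n = 0"
  shows "fourier_coeff (\<lambda>z. D z * complex_of_real (q z)) n = 0"
  using assms
proof (induction q arbitrary: D n)
  case (linear q D n)
  \<comment> \<open>A real-linear functional on the plane has the form 2 Re(\<alpha> z), that is,
    \<alpha> z plus its conjugate.\<close>
  define \<alpha> where "\<alpha> = Complex (q 1 / 2) (- q \<i> / 2)"
  have q: "complex_of_real (q z) = \<alpha> * z + cnj \<alpha> * cnj z" for z
  proof -
    have "q z = q (Re z *\<^sub>R 1 + Im z *\<^sub>R \<i>)"
      by (simp add: scaleR_conv_of_real complex_eq[symmetric] mult.commute)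
    also have "\<dots> = Re z * q 1 + Im z * q \<i>"
      using linear.hyps by (simp add: linear_simps bounded_linear.linear linear_add linear_scale)
    finally show ?thesis
      by (simp add: \<alpha>_def complex_eq_iff)
  qed
  have "fourier_coeff (\<lambda>z. D z * complex_of_real (q z)) n
      = fourier_coeff (\<lambda>z. \<alpha> * (z powi 1 * D z) + cnj \<alpha> * (z powi (-1) * D z)) n"
  proof (rule fourier_coeff_cong)
    fix z assume "z \<in> unit_circle"
    then show "D z * complex_of_real (q z) = \<alpha> * (z powi 1 * D z) + cnj \<alpha> * (z powi (-1) * D z)"
      using cnj_powi_circle[of z 1] by (simp add: q algebra_simps)
  qed
  also have "\<dots> = \<alpha> * fourier_coeff (\<lambda>z. z powi 1 * D z) n + cnj \<alpha> * fourier_coeff (\<lambda>z. z powi (-1) * D z) n"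
    unfolding fourier_coeff_cmult[symmetric] using linear.prems(1)
    by (intro fourier_coeff_add continuous_intros) auto
  finally show ?case
    unfolding fourier_coeff_mult_powi linear.prems(2) by simp
next
  case (const c D n)
  then show ?case using fourier_coeff_cmult[of "complex_of_real c" D n] by (simp add: mult.commute)
next
  case (add p q D n)
  have c: "continuous_on unit_circle p" "continuous_on unit_circle q"
    using add.hyps by (auto simp: real_polynomial_function_eq intro: continuous_on_polymonial_function)
  show ?case
    using add.IH(1)[OF add.prems] add.IH(2)[OF add.prems]
    by (simp add: ring_distribs fourier_coeff_add continuous_intros add.prems c)
next
  case (mult p q D n)
  have c: "continuous_on unit_circle p"
    using mult.hyps by (auto simp: real_polynomial_function_eq intro: continuous_on_polymonial_function)
  show ?case
    using mult.IH(2)[OF continuous_on_mult[OF mult.prems(1)] mult.IH(1)[OF mult.prems]] c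
    by (simp add: mult.assoc continuous_intros)
qed

lemma fourier_coeff_mult_real_eq_0:
  assumes D: "continuous_on unit_circle D" and 0: "\<And>n. fourier_coeff D n = 0"
    and u: "continuous_on unit_circle (u :: complex \<Rightarrow> real)"
  shows "fourier_coeff (\<lambda>z. D z * complex_of_real (u z)) 0 = 0"
proof -
  obtain B where B: "B > 0" "\<And>z. z \<in> unit_circle \<Longrightarrow> norm (D z) \<le> B"
    using continuous_on_circle_bounded[OF D] by blast
  have "norm (fourier_coeff (\<lambda>z. D z * complex_of_real (u z)) 0) \<le> e" if e: "e > 0" for e
  proof -
    have "e / B > 0" using e B by simp
    then obtain q where q: "real_polynomial_function q"
        "\<And>z. z \<in> unit_circle \<Longrightarrow> \<bar>u z - q z\<bar> < e / B"
      using Stone_Weierstrass_real_polynomial_function[OF compact_sphere u] by metis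
    have c: "continuous_on unit_circle q"
      using q by (auto simp: real_polynomial_function_eq intro: continuous_on_polymonial_function)
    have "fourier_coeff (\<lambda>z. D z * complex_of_real (u z)) 0
        = fourier_coeff (\<lambda>z. D z * complex_of_real (u z) - D z * complex_of_real (q z)) 0"
      using fourier_coeff_mult_real_polynomial[OF q(1) D 0]
      by (subst fourier_coeff_diff) (auto intro!: continuous_intros D u c)
    also have "norm \<dots> \<le> e"
    proof (rule norm_fourier_coeff_le)
      fix z assume z: "z \<in> unit_circle"
      have "norm (D z * complex_of_real (u z) - D z * complex_of_real (q z)) = norm (D z) * \<bar>u z - q z\<bar>"
        by (simp add: norm_mult flip: right_diff_distrib of_real_diff)
      also have "\<dots> \<le> B * (e / B)"
        using B q(2)[OF z] z by (intro mult_mono) auto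
      finally show "norm (D z * complex_of_real (u z) - D z * complex_of_real (q z)) \<le> e"
        using B by simp
    qed (use e in auto)
    finally show ?thesis .
  qed
  then show ?thesis
    by (metis dense_ge norm_le_zero_iff)
qed

text \<open>Stone-Weierstrass has turned vanishing coefficients into orthogonality to every
  continuous real function. Testing against Re D and Im D gives that the integral of |D|^2 is 0, and
  continuity turns this into a pointwise statement.\<close>

lemma fourier_coeff_eq_0_imp_eq_0:
  assumes D: "continuous_on unit_circle D" and 0: "\<And>n. fourier_coeff D n = 0"
    and z: "z \<in> unit_circle"
  shows "D z = 0"
proof -
  have c: "continuous_on unit_circle (\<lambda>z. Re (D z))" "continuous_on unit_circle (\<lambda>z. Im (D z))"
    by (intro continuous_intros D)+
  define h where "h = (\<lambda>z. complex_of_real ((cmod (D z))\<^sup>2))"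
  have hc: "continuous_on unit_circle h"
    unfolding h_def by (intro continuous_intros D)
  have "fourier_coeff h 0 =
      fourier_coeff (\<lambda>z. D z * complex_of_real (Re (D z)) - \<i> * (D z * complex_of_real (Im (D z)))) 0"
    by (rule fourier_coeff_cong)
       (simp add: h_def cmod_power2 complex_eq_iff, simp add: power2_eq_square)
  also have "\<dots> = 0"
    using fourier_coeff_mult_real_eq_0[OF D 0 c(1)] fourier_coeff_mult_real_eq_0[OF D 0 c(2)]
    by (subst fourier_coeff_diff) (auto intro!: continuous_intros D simp: fourier_coeff_cmult)
  finally have "integral {0..2*pi} (\<lambda>x. h (cis x)) = 0"
    using circle_integral_eq[OF hc] by (simp add: fourier_coeff_def)
  have hcc: "continuous_on {0..2*pi} (\<lambda>x. (cmod (D (cis x)))\<^sup>2)"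
    by (intro continuous_intros continuous_on_compose2[OF D]) auto
  have "((\<lambda>x. complex_of_real ((cmod (D (cis x)))\<^sup>2)) has_integral
      complex_of_real (integral {0..2*pi} (\<lambda>x. (cmod (D (cis x)))\<^sup>2))) {0..2*pi}"
    using has_integral_linear[OF integrable_integral[OF integrable_continuous_real[OF hcc]]
        bounded_linear_of_real] by (simp add: o_def)
  then have "integral {0..2*pi} (\<lambda>x. (cmod (D (cis x)))\<^sup>2) = 0"
    using \<open>integral {0..2*pi} (\<lambda>x. h (cis x)) = 0\<close>
    by (simp add: h_def integral_unique)
  then have hi: "((\<lambda>x. (cmod (D (cis x)))\<^sup>2) has_integral 0) (cbox 0 (2*pi))"
    using integrable_integral[OF integrable_continuous_real[OF hcc]] by simp
  obtain x where x: "z = cis x" "x \<in> {0..2*pi}"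
  proof
    show "z = cis (Arg2pi z)" using z Arg2pi_eq[of z] by (simp add: cis_conv_exp)
    show "Arg2pi z \<in> {0..2*pi}" using Arg2pi[of z] by simp
  qed
  have "(cmod (D (cis x)))\<^sup>2 = 0"
    by (rule has_integral_0_cbox_imp_0[OF _ _ hi]) (use hcc x pi_gt_zero in \<open>auto simp: box_real simp del: pi_gt_zero\<close>)
  then show ?thesis using x by simp
qed

text \<open>Absolute summability makes the series converge uniformly to a continuous
  \<open>Q\<close>; its coefficients are those of \<open>P\<close>, so uniqueness identifies the
  two. \<open>int_decode\<close> arranges the integers in a sequence, which is harmless for an
  absolutely convergent series.\<close>

lemma fourier_series_converges:
  assumes P: "continuous_on unit_circle P"
    and S: "\<And>F. finite F \<Longrightarrow> (\<Sum>n\<in>F. cmod (fourier_coeff P n)) \<le> S"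
  shows "uniform_limit unit_circle
    (\<lambda>N z. \<Sum>i<N. fourier_coeff P (int_decode i) * z powi int_decode i) P sequentially"
proof -
  define c where "c = fourier_coeff P"
  define s where "s = (\<lambda>N z. \<Sum>i<N. c (int_decode i) * z powi int_decode i)"
  have inj: "inj_on int_decode A" for A
    using inj_int_decode by (rule inj_on_subset) auto
  have "summable (\<lambda>i. cmod (c (int_decode i)))"
  proof (rule bounded_imp_summable)
    fix N
    have "(\<Sum>i\<le>N. cmod (c (int_decode i))) = (\<Sum>n\<in>int_decode ` {..N}. cmod (c n))"
      using inj by (simp add: sum.reindex)
    also have "\<dots> \<le> S" unfolding c_def by (rule S) auto
    finally show "(\<Sum>i\<le>N. cmod (c (int_decode i))) \<le> S" .
  qed auto
  then have lim: "uniform_limit unit_circle s (\<lambda>z. \<Sum>i. c (int_decode i) * z powi int_decode i) sequentially"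
    unfolding s_def by (intro Weierstrass_m_test) (auto simp: norm_mult norm_power_int)
  define Q where "Q = (\<lambda>z. \<Sum>i. c (int_decode i) * z powi int_decode i)"
  have scont: "continuous_on unit_circle (s N)" for N
    unfolding s_def by (intro continuous_intros) auto
  have Q: "continuous_on unit_circle Q"
    unfolding Q_def using lim scont by (intro uniform_limit_theorem[OF _ lim]) auto
  have S0: "S \<ge> 0" using S[of "{}"] by simp
  have "fourier_coeff Q n = c n" for n
  proof (rule LIMSEQ_unique)
    show "(\<lambda>N. fourier_coeff (s N) n) \<longlonglongrightarrow> fourier_coeff Q n"
    proof (rule fourier_coeff_tendsto[where B=S])
      fix N z assume z: "z \<in> unit_circle"
      have "cmod (s N z) \<le> (\<Sum>i<N. cmod (c (int_decode i)))"
        unfolding s_def by (rule order_trans[OF norm_sum]) (use z in \<open>simp add: norm_mult norm_power_int\<close>)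
      also have "\<dots> = (\<Sum>n\<in>int_decode ` {..<N}. cmod (c n))"
        using inj by (simp add: sum.reindex)
      also have "\<dots> \<le> S" unfolding c_def by (rule S) auto
      finally show "cmod (s N z) \<le> S" .
      show "(\<lambda>N. s N z) \<longlonglongrightarrow> Q z"
        using tendsto_uniform_limitI[OF lim z] by (simp add: Q_def)
    qed (rule scont)
    have "fourier_coeff (s N) n = (\<Sum>i<N. if i = int_encode n then c n else 0)" for N
      unfolding s_def
    proof (subst fourier_coeff_sum)
      show "(\<Sum>i<N. fourier_coeff (\<lambda>z. c (int_decode i) * z powi int_decode i) n)
          = (\<Sum>i<N. if i = int_encode n then c n else 0)"
        unfolding fourier_coeff_cmult fourier_coeff_powi by (intro sum.cong) auto
    qed (auto intro!: continuous_intros)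
    then have "fourier_coeff (s N) n = (if int_encode n < N then c n else 0)" for N
      by simp
    then have "eventually (\<lambda>N. fourier_coeff (s N) n = c n) sequentially"
      by (intro eventually_mono[OF eventually_gt_at_top[of "int_encode n"]]) simp
    then show "(\<lambda>N. fourier_coeff (s N) n) \<longlonglongrightarrow> c n"
      by (rule tendsto_eventually)
  qed
  then have "fourier_coeff (\<lambda>z. Q z - P z) n = 0" for n
    by (subst fourier_coeff_diff) (auto intro: P Q simp: c_def)
  then have "Q z = P z" if "z \<in> unit_circle" for z
    using fourier_coeff_eq_0_imp_eq_0[OF continuous_on_diff[OF Q P] _ that] by simp
  then have "uniform_limit unit_circle s P sequentially \<longleftrightarrow> uniform_limit unit_circle s Q sequentially"
    by (intro uniform_limit_cong') auto
  then show ?thesis using lim by (simp add: s_def c_def Q_def)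
qed

section \<open>Multipliers of weighted spaces\<close>

text \<open>Restricting to a finite set of frequencies removes all summability questions: the
  triangle inequality holds directly, and bounds pass to the limit as soon as each single
  coefficient converges. The full weighted norm is the supremum over \<open>F\<close>.\<close>

definition weighted_norm :: "(int \<Rightarrow> real) \<Rightarrow> int set \<Rightarrow> (complex \<Rightarrow> complex) \<Rightarrow> real" where
  "weighted_norm w F f = L2_set (\<lambda>n. sqrt (w n) * cmod (fourier_coeff f n)) F"

definition weighted_norm_le :: "(int \<Rightarrow> real) \<Rightarrow> (complex \<Rightarrow> complex) \<Rightarrow> real \<Rightarrow> bool" where
  "weighted_norm_le w f E \<longleftrightarrow> (\<forall>F. finite F \<longrightarrow> weighted_norm w F f \<le> E)"

text \<open>Continuity of \<open>P\<close> is included so that multipliers can be composed. The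
  operator bound \<open>S\<close> stays existential, since only its finiteness is ever used.\<close>

definition multiplier :: "(int \<Rightarrow> real) \<Rightarrow> (complex \<Rightarrow> complex) \<Rightarrow> bool" where
  "multiplier w P \<longleftrightarrow> continuous_on unit_circle P \<and>
     (\<exists>S\<ge>0. \<forall>f E. continuous_on unit_circle f \<longrightarrow> weighted_norm_le w f E \<longrightarrow>
        weighted_norm_le w (\<lambda>z. P z * f z) (S * E))"

text \<open>A Peetre-type inequality: shifting frequencies by l costs at most a polynomial factor in
  l. This is what makes functions with rapidly decaying coefficients multipliers.\<close>

locale moderate_weight =
  fixes w :: "int \<Rightarrow> real" and L :: real and a :: nat
  assumes pos: "w n > 0"
    and moderate: "w m \<le> L * (1 + real_of_int \<bar>m - n\<bar>) ^ a * w n"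
begin

lemma L_ge_1: "L \<ge> 1"
  using moderate[of 0 0] pos[of 0] by simp

lemma weighted_norm_nonneg: "0 \<le> weighted_norm w F f"
  by (simp add: weighted_norm_def)

lemma weighted_norm_le_nonneg: "weighted_norm_le w f E \<Longrightarrow> 0 \<le> E"
  unfolding weighted_norm_le_def using weighted_norm_nonneg[of "{}" f] by (meson finite.emptyI order_trans)

lemma weighted_norm_add:
  assumes "continuous_on unit_circle f" "continuous_on unit_circle g"
  shows "weighted_norm w F (\<lambda>z. f z + g z) \<le> weighted_norm w F f + weighted_norm w F g"
proof -
  have "weighted_norm w F (\<lambda>z. f z + g z)
      \<le> L2_set (\<lambda>n. sqrt (w n) * cmod (fourier_coeff f n) + sqrt (w n) * cmod (fourier_coeff g n)) F"
    unfolding weighted_norm_def fourier_coeff_add[OF assms]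
    by (rule L2_set_mono) (auto simp: pos less_imp_le norm_triangle_ineq simp flip: distrib_left)
  also have "\<dots> \<le> weighted_norm w F f + weighted_norm w F g"
    unfolding weighted_norm_def by (rule L2_set_triangle_ineq)
  finally show ?thesis .
qed

lemma weighted_norm_cmult: "weighted_norm w F (\<lambda>z. c * f z) = cmod c * weighted_norm w F f"
  unfolding weighted_norm_def fourier_coeff_cmult
  by (subst L2_set_right_distrib) (auto simp: norm_mult mult_ac)

lemma weighted_norm_sum:
  assumes "\<And>i. i \<in> I \<Longrightarrow> continuous_on unit_circle (f i)"
  shows "weighted_norm w F (\<lambda>z. \<Sum>i\<in>I. f i z) \<le> (\<Sum>i\<in>I. weighted_norm w F (f i))"
  using assms
proof (induction I rule: infinite_finite_induct)
  case (insert i I)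
  have "weighted_norm w F (\<lambda>z. f i z + (\<Sum>i\<in>I. f i z))
      \<le> weighted_norm w F (f i) + weighted_norm w F (\<lambda>z. \<Sum>i\<in>I. f i z)"
    using insert.prems by (intro weighted_norm_add continuous_on_sum) simp_all
  also have "\<dots> \<le> weighted_norm w F (f i) + (\<Sum>i\<in>I. weighted_norm w F (f i))"
    using insert.IH insert.prems by simp
  finally show ?case using insert.hyps by simp
qed (simp_all add: weighted_norm_def fourier_coeff_const L2_set_def)

lemma weighted_norm_mult_powi:
  assumes "weighted_norm_le w f E" "finite F"
  shows "weighted_norm w F (\<lambda>z. z powi l * f z) \<le> L * (1 + real_of_int \<bar>l\<bar>) ^ a * E"
proof -
  define K where "K = L * (1 + real_of_int \<bar>l\<bar>) ^ a"
  have "1 ^ a \<le> (1 + real_of_int \<bar>l\<bar>) ^ a" by (intro power_mono) auto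
  then have K: "1 \<le> K" unfolding K_def using L_ge_1 mult_mono[of 1 L 1 "(1 + real_of_int \<bar>l\<bar>) ^ a"] by simp
  \<comment> \<open>The natural constant is \<open>sqrt K\<close>; since \<open>K \<ge> 1\<close> it
    may be enlarged to \<open>K\<close>, which avoids roots in the later sums.\<close>
  have sq: "sqrt K \<le> K" using K real_sqrt_le_iff[of K "K ^ 2"] self_le_power[of K 2] by simp
  have "sqrt (w n) \<le> K * sqrt (w (n - l))" for n
  proof -
    have "sqrt (w n) \<le> sqrt (K * w (n - l))"
      using moderate[of n "n - l"] by (simp add: K_def)
    also have "\<dots> \<le> K * sqrt (w (n - l))"
      using sq pos[of "n - l"] by (auto simp: real_sqrt_mult intro: mult_right_mono)
    finally show ?thesis .
  qed
  then have "weighted_norm w F (\<lambda>z. z powi l * f z)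
      \<le> L2_set (\<lambda>n. K * (sqrt (w (n - l)) * cmod (fourier_coeff f (n - l)))) F"
    unfolding weighted_norm_def fourier_coeff_mult_powi mult.assoc[symmetric]
    by (intro L2_set_mono mult_right_mono) (auto simp: pos less_imp_le)
  also have "\<dots> = K * L2_set (\<lambda>n. sqrt (w (n - l)) * cmod (fourier_coeff f (n - l))) F"
    using K by (subst L2_set_right_distrib) auto
  \<comment> \<open>A shift of the coefficients amounts to a shift of \<open>F\<close>, and the
    hypothesis covers every finite set.\<close>
  also have "L2_set (\<lambda>n. sqrt (w (n - l)) * cmod (fourier_coeff f (n - l))) F
      = weighted_norm w ((\<lambda>n. n - l) ` F) f"
    unfolding weighted_norm_def L2_set_def by (subst sum.reindex) (auto simp: inj_on_def)
  also have "K * \<dots> \<le> K * E"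
    using K assms by (intro mult_left_mono) (auto simp: weighted_norm_le_def)
  finally show ?thesis by (simp add: K_def)
qed

lemma weighted_norm_tendsto_le:
  assumes "\<And>k. weighted_norm w F (f k) \<le> E"
    and "\<And>n. (\<lambda>k. fourier_coeff (f k) n) \<longlonglongrightarrow> fourier_coeff g n"
  shows "weighted_norm w F g \<le> E"
proof (rule LIMSEQ_le_const2)
  show "(\<lambda>k. weighted_norm w F (f k)) \<longlonglongrightarrow> weighted_norm w F g"
    unfolding weighted_norm_def L2_set_def by (intro tendsto_intros assms)
qed (use assms(1) in auto)

text \<open>\<open>P\<close> is expanded in its Fourier series. Multiplication by the character of
  frequency l costs \<open>L * (1 + \<bar>l\<bar>) ^ a\<close>, so each partial sum is bounded by
  \<open>L * S\<close>, and the bound survives the limit coefficient by coefficient.\<close>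

lemma multiplierI:
  assumes P: "continuous_on unit_circle P"
    and S: "\<And>F. finite F \<Longrightarrow> (\<Sum>l\<in>F. cmod (fourier_coeff P l) * (1 + real_of_int \<bar>l\<bar>) ^ a) \<le> S"
  shows "multiplier w P"
  unfolding multiplier_def
proof (intro conjI exI allI impI)
  have S0: "S \<ge> 0" using S[of "{}"] by simp
  then show "0 \<le> L * S" using L_ge_1 by simp
  fix f E assume f: "continuous_on unit_circle f" "weighted_norm_le w f E"
  note E0 = weighted_norm_le_nonneg[OF f(2)]
  have S1: "(\<Sum>n\<in>F. cmod (fourier_coeff P n)) \<le> S" if "finite F" for F
  proof -
    have "cmod (fourier_coeff P n) * 1 \<le> cmod (fourier_coeff P n) * (1 + real_of_int \<bar>n\<bar>) ^ a" for n
      by (intro mult_left_mono one_le_power) auto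
    then have "(\<Sum>n\<in>F. cmod (fourier_coeff P n))
        \<le> (\<Sum>l\<in>F. cmod (fourier_coeff P l) * (1 + real_of_int \<bar>l\<bar>) ^ a)"
      by (intro sum_mono) simp
    then show ?thesis using S[OF that] by linarith
  qed
  define s where "s = (\<lambda>N z. \<Sum>i<N. fourier_coeff P (int_decode i) * z powi int_decode i)"
  have inj: "inj_on int_decode A" for A
    using inj_int_decode by (rule inj_on_subset) auto
  have scont: "continuous_on unit_circle (s N)" for N
    unfolding s_def by (intro continuous_intros) auto
  have lim: "uniform_limit unit_circle s P sequentially"
    unfolding s_def by (rule fourier_series_converges[OF P S1])
  obtain B where B: "B > 0" "\<And>z. z \<in> unit_circle \<Longrightarrow> norm (f z) \<le> B"
    using continuous_on_circle_bounded[OF f(1)] by blast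
  have fc: "(\<lambda>N. fourier_coeff (\<lambda>z. s N z * f z) n) \<longlonglongrightarrow> fourier_coeff (\<lambda>z. P z * f z) n" for n
  proof (rule fourier_coeff_tendsto[where B="S * B"])
    fix N z assume z: "z \<in> unit_circle"
    have "cmod (s N z) \<le> (\<Sum>i<N. cmod (fourier_coeff P (int_decode i)))"
      unfolding s_def by (rule order_trans[OF norm_sum]) (use z in \<open>simp add: norm_mult norm_power_int\<close>)
    also have "\<dots> = (\<Sum>n\<in>int_decode ` {..<N}. cmod (fourier_coeff P n))"
      using inj by (simp add: sum.reindex)
    also have "\<dots> \<le> S" by (rule S1) auto
    finally show "cmod (s N z * f z) \<le> S * B"
      unfolding norm_mult using B z S0 by (intro mult_mono) auto
    show "(\<lambda>N. s N z * f z) \<longlonglongrightarrow> P z * f z"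
      by (intro tendsto_mult tendsto_const tendsto_uniform_limitI[OF lim z])
  qed (intro continuous_on_mult scont f)
  have "weighted_norm w F (\<lambda>z. s N z * f z) \<le> L * S * E" if F: "finite F" for F N
  proof -
    have "weighted_norm w F (\<lambda>z. s N z * f z)
        = weighted_norm w F (\<lambda>z. \<Sum>i<N. fourier_coeff P (int_decode i) * (z powi int_decode i * f z))"
      by (simp add: s_def sum_distrib_right mult.assoc)
    also have "\<dots> \<le> (\<Sum>i<N. weighted_norm w F (\<lambda>z. fourier_coeff P (int_decode i) * (z powi int_decode i * f z)))"
      by (rule weighted_norm_sum) (auto intro!: continuous_intros f)
    also have "\<dots> \<le> (\<Sum>i<N. cmod (fourier_coeff P (int_decode i)) * (L * (1 + real_of_int \<bar>int_decode i\<bar>) ^ a * E))"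
      unfolding weighted_norm_cmult
      by (intro sum_mono mult_left_mono weighted_norm_mult_powi f F) auto
    also have "\<dots> = L * (\<Sum>i<N. cmod (fourier_coeff P (int_decode i)) * (1 + real_of_int \<bar>int_decode i\<bar>) ^ a) * E"
      by (simp add: sum_distrib_left sum_distrib_right mult_ac)
    also have "(\<Sum>i<N. cmod (fourier_coeff P (int_decode i)) * (1 + real_of_int \<bar>int_decode i\<bar>) ^ a)
        = (\<Sum>n\<in>int_decode ` {..<N}. cmod (fourier_coeff P n) * (1 + real_of_int \<bar>n\<bar>) ^ a)"
      using inj by (simp add: sum.reindex)
    also have "L * \<dots> * E \<le> L * S * E"
      using L_ge_1 E0 by (intro mult_right_mono mult_left_mono S) auto
    finally show ?thesis .
  qed
  then show "weighted_norm_le w (\<lambda>z. P z * f z) (L * S * E)"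
    unfolding weighted_norm_le_def by (intro allI impI weighted_norm_tendsto_le[OF _ fc])
qed (rule P)

lemma multiplier_mult:
  assumes "multiplier w P" "multiplier w Q"
  shows "multiplier w (\<lambda>z. P z * Q z)"
proof -
  have c: "continuous_on unit_circle P" "continuous_on unit_circle Q"
    using assms by (simp_all add: multiplier_def)
  obtain S where S: "S \<ge> 0"
    "\<And>f E. continuous_on unit_circle f \<Longrightarrow> weighted_norm_le w f E \<Longrightarrow> weighted_norm_le w (\<lambda>z. P z * f z) (S * E)"
    using assms(1) unfolding multiplier_def by blast
  obtain T where T: "T \<ge> 0"
    "\<And>f E. continuous_on unit_circle f \<Longrightarrow> weighted_norm_le w f E \<Longrightarrow> weighted_norm_le w (\<lambda>z. Q z * f z) (T * E)"
    using assms(2) unfolding multiplier_def by blast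
  have "weighted_norm_le w (\<lambda>z. P z * Q z * f z) (S * T * E)"
    if f: "continuous_on unit_circle f" "weighted_norm_le w f E" for f E
    using S(2)[OF continuous_on_mult[OF c(2) f(1)] T(2)[OF f]] by (simp add: mult.assoc)
  moreover have "0 \<le> S * T" using S T by simp
  moreover have "continuous_on unit_circle (\<lambda>z. P z * Q z)"
    using c by (rule continuous_on_mult)
  ultimately show ?thesis unfolding multiplier_def by blast
qed

lemma multiplier_1: "multiplier w (\<lambda>z. 1)"
  unfolding multiplier_def by (intro conjI exI[of _ "1::real"]) simp_all

end

section \<open>Bump functions\<close>

text \<open>A weak form of Jordan's inequality. The Taylor bound gives sin x >= 5x/6 on [0,1];
  beyond 1, monotonicity keeps sin x >= 5/6, which exceeds pi/4 >= x/2.\<close>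

lemma half_le_sin:
  assumes "0 \<le> x" "x \<le> pi / 2"
  shows "x / 2 \<le> sin x"
proof -
  have *: "y / 2 \<le> sin y \<and> 5 / 6 * y \<le> sin y" if "0 \<le> y" "y \<le> 1" for y :: real
  proof -
    have "\<bar>sin y - y\<bar> \<le> y ^ 3 / 6"
      using Maclaurin_sin_bound[of y 3] that by (simp add: eval_nat_numeral sin_coeff_def fact_numeral)
    moreover have "y ^ 3 \<le> y"
      using that power_decreasing[of 1 3 y] by simp
    ultimately show ?thesis using that by linarith
  qed
  show ?thesis
  proof (cases "x \<le> 1")
    case False
    have "sin 1 \<le> sin x" using assms False by (intro sin_monotone_2pi_le) auto
    moreover have "x / 2 \<le> 5 / 6" using assms pi_less_4 pi_approx by simp
    ultimately show ?thesis using *[of 1] by linarith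
  qed (use * assms in auto)
qed

lemma norm_cis_minus_1: "cmod (cis t - 1) = 2 * \<bar>sin (t / 2)\<bar>"
  using dist_exp_i_1[of t] by (simp add: cis_conv_exp)

lemma norm_cis_minus_1_le: "cmod (cis t - 1) \<le> \<bar>t\<bar>"
  using abs_sin_x_le_abs_x[of "t / 2"] by (simp add: norm_cis_minus_1)

lemma norm_cis_minus_1_ge: "0 \<le> t \<Longrightarrow> t \<le> pi \<Longrightarrow> t / 2 \<le> cmod (cis t - 1)"
  using half_le_sin[of "t / 2"] by (simp add: norm_cis_minus_1)

lemma norm_rotate_minus_1_le:
  assumes "z \<in> unit_circle"
  shows "cmod (z * cis t - 1) \<le> cmod (z - 1) + \<bar>t\<bar>"
proof -
  have "z * cis t - 1 = (z - 1) * cis t + (cis t - 1)" by (simp add: algebra_simps)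
  then have "cmod (z * cis t - 1) \<le> cmod ((z - 1) * cis t) + cmod (cis t - 1)"
    by (metis norm_triangle_ineq)
  then show ?thesis using norm_cis_minus_1_le[of t] by (simp add: norm_mult)
qed

lemma norm_rotate_minus_1_ge:
  assumes "z \<in> unit_circle"
  shows "cmod (z - 1) \<le> cmod (z * cis t - 1) + \<bar>t\<bar>"
  using norm_rotate_minus_1_le[of "z * cis t" "-t"] assms by (simp add: norm_mult mult.assoc cis_mult)

text \<open>\<rho> is the radius of the plateau and r that of the support, both in chordal distance
  from the point 1. Values range over [-1,1] because a bump with mean zero has to change
  sign.\<close>

definition bump :: "real \<Rightarrow> real \<Rightarrow> (complex \<Rightarrow> real) \<Rightarrow> bool" where
  "bump \<rho> r u \<longleftrightarrow> continuous_on unit_circle u \<and>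
     (\<forall>z\<in>unit_circle. \<bar>u z\<bar> \<le> 1 \<and> (cmod (z - 1) \<le> \<rho> \<longrightarrow> u z = 1) \<and> (r \<le> cmod (z - 1) \<longrightarrow> u z = 0))"

abbreviation fc :: "(complex \<Rightarrow> real) \<Rightarrow> int \<Rightarrow> complex" where
  "fc u \<equiv> fourier_coeff (\<lambda>z. complex_of_real (u z))"

lemma continuous_on_circle_of_real:
  "continuous_on unit_circle u \<Longrightarrow> continuous_on unit_circle (\<lambda>z. complex_of_real (u z))"
  by (intro continuous_intros)

text \<open>
  Both the averages and the differences multiply the Fourier coefficients by explicit factors: the former
  gain decay at high frequencies, the latter at low ones.
\<close>

lemma bump_difference:
  assumes u: "bump \<rho> r u" and r: "\<rho> \<le> r" "0 < r" "4 * r \<le> 1"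
  obtains v where "bump \<rho> (5 * r) v"
    "\<And>n. cmod (fc v n) \<le> 2 * cmod (fc u n)"
    "\<And>n. cmod (fc v n) \<le> 4 * r * real_of_int \<bar>n\<bar> * cmod (fc u n)"
proof
  \<comment> \<open>Rotation by \<open>4 * r\<close> moves every point by a chord of at least
    \<open>2 * r\<close>, so the sets where the two copies are nonzero are disjoint and the sup
    bound 1 is kept. The support grows to \<open>r + 4 * r\<close>, and |1 - cis(n h)| <= h |n|
    gives the low-frequency gain.\<close>
  define h where "h = 4 * r"
  define v where "v = (\<lambda>z. u z - u (z * cis h))"
  have h: "0 \<le> h" "h \<le> pi" using r pi_gt3 by (auto simp: h_def)
  have c: "continuous_on unit_circle u" using u by (simp add: bump_def)
  have far: "u (z * cis h) = 0" if "z \<in> unit_circle" "cmod (z - 1) \<le> r" for z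
  proof -
    have "cmod (cis h - 1) \<le> cmod (z * cis h - 1) + cmod (z - 1)"
    proof -
      have "cis h - 1 = (z * cis h - 1) - (z - 1) * cis h" by (simp add: algebra_simps)
      then have "cmod (cis h - 1) \<le> cmod (z * cis h - 1) + cmod ((z - 1) * cis h)"
        by (metis norm_triangle_ineq4)
      then show ?thesis by (simp add: norm_mult)
    qed
    then have "r \<le> cmod (z * cis h - 1)"
      using norm_cis_minus_1_ge[OF h] that by (simp add: h_def)
    then show ?thesis using u that by (auto simp: bump_def norm_mult)
  qed
  show "bump \<rho> (5 * r) v"
    unfolding bump_def
  proof (intro conjI ballI impI)
    show "continuous_on unit_circle v"
      unfolding v_def by (intro continuous_intros c continuous_on_circle_rotate)
    fix z assume z: "z \<in> unit_circle"
    then have zc: "z * cis h \<in> unit_circle" by (simp add: norm_mult)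
    show "\<bar>v z\<bar> \<le> 1"
    proof (cases "cmod (z - 1) \<le> r")
      case True
      then show ?thesis using far[OF z] u z by (simp add: v_def bump_def)
    next
      case False
      then show ?thesis using u z zc by (simp add: v_def bump_def)
    qed
    show "v z = 1" if "cmod (z - 1) \<le> \<rho>"
      using far[OF z] u z that r by (simp add: v_def bump_def)
    show "v z = 0" if "5 * r \<le> cmod (z - 1)"
      using norm_rotate_minus_1_ge[OF z, of h] u z zc that r h by (simp add: v_def bump_def h_def)
  qed
  have fcv: "fc v n = (1 - cis (of_int n * h)) * fc u n" for n
    unfolding v_def of_real_diff
    using fourier_coeff_rotate[OF continuous_on_circle_of_real[OF c], of h n]
    by (subst fourier_coeff_diff) (auto intro!: continuous_on_circle_of_real c continuous_on_circle_rotate simp: algebra_simps)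
  show "cmod (fc v n) \<le> 2 * cmod (fc u n)" for n
    unfolding fcv norm_mult using norm_triangle_ineq4[of 1 "cis (of_int n * h)"] by (intro mult_right_mono) auto
  show "cmod (fc v n) \<le> 4 * r * real_of_int \<bar>n\<bar> * cmod (fc u n)" for n
    unfolding fcv norm_mult using norm_cis_minus_1_le[of "of_int n * h"] r
    by (intro mult_right_mono) (auto simp: h_def norm_minus_commute abs_mult mult_ac)
qed

text \<open>A moving average over the arc [0, \<rho>/2] multiplies the n-th coefficient by the mean
  of cis(n t), which is at most 1 and at most 4/(\<rho>|n|) in modulus. One power of decay is bought
  with half of the plateau.\<close>

lemma bump_average:
  assumes u: "bump \<rho> r u" and \<rho>: "0 < \<rho>"
  obtains v where "bump (\<rho> / 2) (r + \<rho> / 2) v"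
    "\<And>n. cmod (fc v n) \<le> cmod (fc u n)"
    "\<And>n. cmod (fc v n) * real_of_int \<bar>n\<bar> \<le> 4 / \<rho> * cmod (fc u n)"
proof
  define h where "h = \<rho> / 2"
  have h: "0 < h" using \<rho> by (simp add: h_def)
  define v where "v = (\<lambda>z. integral {0..h} (\<lambda>t. u (z * cis t)) / h)"
  have c: "continuous_on unit_circle u" using u by (simp add: bump_def)
  have ct: "continuous_on {0..h} (\<lambda>t. u (z * cis t))" if "z \<in> unit_circle" for z
    by (intro continuous_on_compose2[OF c]) (use that in \<open>auto intro!: continuous_intros simp: norm_mult\<close>)
  note int = integrable_continuous_real[OF ct]
  have const: "v z = k" if z: "z \<in> unit_circle" and k: "\<And>t. t \<in> {0..h} \<Longrightarrow> u (z * cis t) = k" for z k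
  proof -
    have "integral {0..h} (\<lambda>t. u (z * cis t)) = integral {0..h} (\<lambda>t. k)"
      by (rule Henstock_Kurzweil_Integration.integral_cong) (rule k)
    then show ?thesis using h by (simp add: v_def)
  qed
  have vc: "continuous_on unit_circle v"
  proof -
    have "continuous_on (unit_circle \<times> cbox 0 h) (\<lambda>(z, t). u (z * cis t))"
      unfolding case_prod_beta
      by (intro continuous_on_compose2[OF c]) (auto intro!: continuous_intros simp: norm_mult)
    then have "continuous_on unit_circle (\<lambda>z. integral (cbox 0 h) (\<lambda>t. u (z * cis t)))"
      by (rule integral_continuous_on_param)
    then show ?thesis unfolding v_def using h by (intro continuous_intros) auto
  qed
  show "bump (\<rho> / 2) (r + \<rho> / 2) v"
    unfolding bump_def
  proof (intro conjI ballI impI)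
    fix z assume z: "z \<in> unit_circle"
    have "norm (integral {0..h} (\<lambda>t. u (z * cis t))) \<le> 1 * (h - 0)"
      by (rule integral_bound) (use z h u ct in \<open>auto simp: bump_def norm_mult\<close>)
    then show "\<bar>v z\<bar> \<le> 1" using h by (simp add: v_def)
    show "v z = 1" if "cmod (z - 1) \<le> \<rho> / 2"
    proof (rule const[OF z])
      fix t assume "t \<in> {0..h}"
      then show "u (z * cis t) = 1"
        using norm_rotate_minus_1_le[OF z, of t] that z u by (auto simp: bump_def norm_mult h_def)
    qed
    show "v z = 0" if "r + \<rho> / 2 \<le> cmod (z - 1)"
    proof (rule const[OF z])
      fix t assume "t \<in> {0..h}"
      then show "u (z * cis t) = 0"
        using norm_rotate_minus_1_ge[OF z, of t] that z u by (auto simp: bump_def norm_mult h_def)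
    qed
  qed (rule vc)
  have fcv: "fc v n = fc u n * (integral {0..h} (\<lambda>t. cis (of_int n * t)) / h)" for n
  proof -
    define g where "g = (\<lambda>z. complex_of_real (u z) * cnj z powi n)"
    define k where "k = (\<lambda>x t. complex_of_real (u (cis x * cis t)) * cnj (cis x) powi n)"
    have "fc v n = integral {0..2*pi} (\<lambda>x. complex_of_real (v (cis x)) * cnj (cis x) powi n) / (2 * pi)"
      unfolding fourier_coeff_def
      by (rule circle_integral_eq) (intro continuous_intros vc)
    also have "(\<lambda>x. complex_of_real (v (cis x)) * cnj (cis x) powi n) = (\<lambda>x. integral {0..h} (k x) / h)"
    proof
      fix x
      have "complex_of_real (integral {0..h} (\<lambda>t. u (cis x * cis t)))
          = integral {0..h} (\<lambda>t. complex_of_real (u (cis x * cis t)))"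
        using integral_linear[OF int bounded_linear_of_real[where 'a=complex], of "cis x"] by (simp add: o_def)
      then show "complex_of_real (v (cis x)) * cnj (cis x) powi n = integral {0..h} (k x) / h"
        by (simp add: v_def k_def)
    qed
    also have "integral {0..2*pi} (\<lambda>x. integral {0..h} (k x) / h)
        = integral {0..2*pi} (\<lambda>x. integral {0..h} (k x)) / h"
      by simp
    \<comment> \<open>After the exchange of integrals the inner one is, for fixed t, the coefficient
      of a rotated copy of \<open>u\<close>, which carries the factor cis(n t).\<close>
    also have "integral {0..2*pi} (\<lambda>x. integral {0..h} (k x)) = integral {0..h} (\<lambda>t. integral {0..2*pi} (\<lambda>x. k x t))"
      unfolding cbox_interval[symmetric]
    proof (rule integral_swap_continuous)
      show "continuous_on (cbox (0, 0) (2 * pi, h)) (\<lambda>(x, t). k x t)"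
        unfolding k_def case_prod_beta
        by (intro continuous_intros continuous_on_compose2[OF c]) (auto simp: norm_mult)
    qed
    also have "(\<lambda>t. integral {0..2*pi} (\<lambda>x. k x t)) = (\<lambda>t. cis (of_int n * t) * (fc u n * (2 * pi)))"
    proof
      fix t
      have "fourier_coeff (\<lambda>z. complex_of_real (u (z * cis t))) n = integral {0..2*pi} (\<lambda>x. k x t) / (2 * pi)"
        unfolding fourier_coeff_def k_def
        by (rule circle_integral_eq) (intro continuous_intros continuous_on_circle_rotate c)
      then show "integral {0..2*pi} (\<lambda>x. k x t) = cis (of_int n * t) * (fc u n * (2 * pi))"
        using fourier_coeff_rotate[OF continuous_on_circle_of_real[OF c], of t n] by (simp add: field_simps)
    qed
    also have "integral {0..h} (\<lambda>t. cis (of_int n * t) * (fc u n * (2 * pi))) =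
        integral {0..h} (\<lambda>t. cis (of_int n * t)) * (fc u n * (2 * pi))"
      by simp
    finally show ?thesis by simp
  qed
  have cc: "continuous_on {0..h} (\<lambda>t. cis (of_int n * t))" for n
    by (intro continuous_intros)
  have "cmod (integral {0..h} (\<lambda>t. cis (of_int n * t))) \<le> 1 * (h - 0)" for n
    by (rule integral_bound) (use h cc in auto)
  then have "cmod (integral {0..h} (\<lambda>t. cis (of_int n * t)) / h) \<le> 1" for n
    using h by (simp add: norm_divide)
  then show "cmod (fc v n) \<le> cmod (fc u n)" for n
    unfolding fcv norm_mult by (intro mult_left_le) auto
  show "cmod (fc v n) * real_of_int \<bar>n\<bar> \<le> 4 / \<rho> * cmod (fc u n)" for n
  proof (cases "n = 0")
    case False
    define F where "F = (\<lambda>t. cis (of_int n * t) / (\<i> * of_int n))"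
    have "((\<lambda>t. cis (of_int n * t)) has_integral (F h - F 0)) {0..h}"
    proof (rule fundamental_theorem_of_calculus)
      fix t assume "t \<in> {0..h}"
      have "((\<lambda>t. exp (\<i> * of_int n * complex_of_real t) / (\<i> * of_int n)) has_vector_derivative
          exp (\<i> * of_int n * complex_of_real t)) (at t within {0..h})"
        using False by (intro has_vector_derivative_real_field) (auto intro!: derivative_eq_intros)
      then show "(F has_vector_derivative cis (of_int n * t)) (at t within {0..h})"
        by (simp add: F_def cis_conv_exp mult.assoc)
    qed (use h in auto)
    then have "integral {0..h} (\<lambda>t. cis (of_int n * t)) = (cis (of_int n * h) - 1) / (\<i> * of_int n)"
      by (simp add: integral_unique F_def diff_divide_distrib)
    then have "cmod (integral {0..h} (\<lambda>t. cis (of_int n * t)) / h) * \<bar>n\<bar> = cmod (cis (of_int n * h) - 1) / h"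
      using False h by (simp add: norm_divide norm_mult)
    also have "\<dots> \<le> 2 / h"
      using h norm_triangle_ineq4[of "cis (of_int n * h)" 1] by (intro divide_right_mono) auto
    also have "2 / h = 4 / \<rho>" by (simp add: h_def)
    finally have "cmod (fc u n) * (cmod (integral {0..h} (\<lambda>t. cis (of_int n * t)) / h) * \<bar>n\<bar>)
        \<le> cmod (fc u n) * (4 / \<rho>)"
      by (rule mult_left_mono) auto
    then show ?thesis
      unfolding fcv norm_mult by (simp only: mult_ac)
  qed (use \<rho> in simp)
qed

text \<open>The starting profile is a trapezoid in chordal distance. A chord is at least half its
  arc, so the support lies within two arcs of length 4/T, and the trivial L^1 estimate gives
  8/T.\<close>

lemma bump_hat:
  assumes T: "T \<ge> 1"
  obtains u where "bump (1 / T) (2 / T) u" "\<And>n. cmod (fc u n) \<le> 8 / T"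
proof
  define u where "u = (\<lambda>z::complex. max 0 (min 1 (2 - T * cmod (z - 1))))"
  have c: "continuous_on unit_circle u"
    unfolding u_def by (intro continuous_intros)
  show "bump (1 / T) (2 / T) u"
    unfolding bump_def
  proof (intro conjI ballI impI)
    fix z :: complex
    show "\<bar>u z\<bar> \<le> 1" by (simp add: u_def)
    show "u z = 1" if "cmod (z - 1) \<le> 1 / T"
      using that T by (simp add: u_def field_simps)
    show "u z = 0" if "2 / T \<le> cmod (z - 1)"
      using that T by (simp add: u_def field_simps)
  qed (rule c)
  \<comment> \<open>The point 1 corresponds to both ends of [0, 2 pi], hence two indicators. Where
    they overlap the majorant is 2, which does no harm.\<close>
  define g where "g = (\<lambda>x::real. (if x \<in> {0..4 / T} then 1 else 0) + (if x \<in> {2 * pi - 4 / T..2 * pi} then 1 else 0 :: real))"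
  have T4: "4 / T \<le> 2 * pi"
  proof -
    have "4 / T \<le> 4" using T by (simp add: field_simps)
    then show ?thesis using pi_gt3 by linarith
  qed
  have one: "((\<lambda>x::real. 1 :: real) has_integral b - a) {a..b}" if "a \<le> b" for a b :: real
    using has_integral_const_real[of "1::real" a b] that by simp
  have g: "(g has_integral (8 / T)) {0..2*pi}"
  proof -
    have "((\<lambda>x. if x \<in> {0..4 / T} then 1 else 0 :: real) has_integral (4 / T - 0)) {0..2*pi}"
      using T4 T one[of 0 "4 / T"] by (subst has_integral_restrict) auto
    moreover have "((\<lambda>x. if x \<in> {2 * pi - 4 / T..2 * pi} then 1 else 0 :: real)
        has_integral (2 * pi - (2 * pi - 4 / T))) {0..2*pi}"
      using T4 T one[of "2 * pi - 4 / T" "2 * pi"] by (subst has_integral_restrict) auto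
    ultimately have "(g has_integral (4 / T - 0 + (2 * pi - (2 * pi - 4 / T)))) {0..2*pi}"
      unfolding g_def by (rule has_integral_add)
    then show ?thesis by simp
  qed
  have ug: "\<bar>u (cis x)\<bar> \<le> g x" if x: "x \<in> {0..2*pi}" for x
  proof -
    have "x / 2 \<le> cmod (cis x - 1)" if "x \<le> pi"
      using norm_cis_minus_1_ge[of x] x that by auto
    moreover have "(2 * pi - x) / 2 \<le> cmod (cis x - 1)" if "\<not> x \<le> pi"
    proof -
      have "(2 * pi - x) / 2 \<le> cmod (cis (2 * pi - x) - 1)"
        using norm_cis_minus_1_ge[of "2 * pi - x"] x that by auto
      also have "cis (2 * pi - x) = cnj (cis x)"
        by (simp add: cis_cnj cis_divide[symmetric] cis_inverse flip: inverse_eq_divide)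
      also have "cmod (cnj (cis x) - 1) = cmod (cis x - 1)"
        by (metis complex_cnj_diff complex_cnj_one complex_mod_cnj)
      finally show ?thesis .
    qed
    ultimately have "x \<le> 2 * cmod (cis x - 1) \<or> 2 * pi - x \<le> 2 * cmod (cis x - 1)"
      by (cases "x \<le> pi") simp_all
    moreover have "u (cis x) = 0" if "\<not> cmod (cis x - 1) \<le> 2 / T"
      using that T by (simp add: u_def field_simps)
    moreover have "\<bar>u (cis x)\<bar> \<le> 1" by (simp add: u_def)
    moreover have "a \<le> 4 / T" if "a \<le> 2 * c" "c \<le> 2 / T" for a c
      using that by linarith
    ultimately have "u (cis x) = 0 \<or> x \<in> {0..4 / T} \<or> x \<in> {2 * pi - 4 / T..2 * pi}"
      using x by (smt (verit) atLeastAtMost_iff)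
    then show ?thesis
      using \<open>\<bar>u (cis x)\<bar> \<le> 1\<close> by (auto simp: g_def)
  qed
  fix n
  have "fc u n = integral {0..2*pi} (\<lambda>x. complex_of_real (u (cis x)) * cnj (cis x) powi n) / (2 * pi)"
    unfolding fourier_coeff_def by (rule circle_integral_eq) (intro continuous_intros c)
  also have "cmod \<dots> = cmod (integral {0..2*pi} (\<lambda>x. complex_of_real (u (cis x)) * cnj (cis x) powi n)) / (2 * pi)"
    by (simp add: norm_divide)
  also have "\<dots> \<le> (8 / T) / (2 * pi)"
  proof (rule divide_right_mono)
    have "continuous_on {0..2*pi} (\<lambda>x. complex_of_real (u (cis x)) * cnj (cis x) powi n)"
      by (intro continuous_intros continuous_on_compose2[OF c]) auto
    then have "(\<lambda>x. complex_of_real (u (cis x)) * cnj (cis x) powi n) integrable_on {0..2*pi}"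
      by (rule integrable_continuous_real)
    then have "cmod (integral {0..2*pi} (\<lambda>x. complex_of_real (u (cis x)) * cnj (cis x) powi n))
        \<le> integral {0..2*pi} g"
      by (rule integral_norm_bound_integral) (use g ug in \<open>auto simp: norm_mult norm_power_int\<close>)
    then show "cmod (integral {0..2*pi} (\<lambda>x. complex_of_real (u (cis x)) * cnj (cis x) powi n)) \<le> 8 / T"
      using g by (simp add: integral_unique)
  qed auto
  also have "\<dots> \<le> 8 / T"
  proof -
    have "1 \<le> 2 * pi" using pi_gt3 by linarith
    then have "(8 / T) / (2 * pi) \<le> (8 / T) / 1" using T by (intro divide_left_mono) auto
    then show ?thesis by simp
  qed
  finally show "cmod (fc u n) \<le> 8 / T" .
qed

text \<open>Averaging the trapezoid p times. The constants do not depend on \<open>T\<close>: the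
  bounds are those of one fixed profile shrunk by the factor 1/T. Writing the power of |n| on the
  left avoids a division at \<open>n = 0\<close>.\<close>

lemma bump_smooth:
  "\<exists>\<rho> R K. 0 < \<rho> \<and> \<rho> \<le> R \<and> 0 \<le> K \<and> (\<forall>T\<ge>1. \<exists>u. bump (\<rho> / T) (R / T) u \<and>
     (\<forall>n. cmod (fc u n) \<le> K / T \<and> cmod (fc u n) * real_of_int \<bar>n\<bar> ^ p \<le> K / T * T ^ p))"
proof (induction p)
  case 0
  show ?case
  proof (rule exI[of _ 1], rule exI[of _ 2], rule exI[of _ 8], intro conjI allI impI)
    fix T :: real assume "T \<ge> 1"
    then obtain u where "bump (1 / T) (2 / T) u" "\<And>n. cmod (fc u n) \<le> 8 / T"
      using bump_hat by blast
    then show "\<exists>u. bump (1 / T) (2 / T) u \<and>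
        (\<forall>n. cmod (fc u n) \<le> 8 / T \<and> cmod (fc u n) * real_of_int \<bar>n\<bar> ^ 0 \<le> 8 / T * T ^ 0)"
      by (intro exI[of _ u]) simp
  qed auto
next
  case (Suc p)
  then obtain \<rho> R K where *: "0 < \<rho>" "\<rho> \<le> R" "0 \<le> K" and ex: "\<And>T. T \<ge> 1 \<Longrightarrow> \<exists>u. bump (\<rho> / T) (R / T) u \<and>
     (\<forall>n. cmod (fc u n) \<le> K / T \<and> cmod (fc u n) * real_of_int \<bar>n\<bar> ^ p \<le> K / T * T ^ p)"
    by blast
  define K' where "K' = max K (4 / \<rho> * K)"
  have "\<exists>u. bump (\<rho> / 2 / T) ((R + \<rho> / 2) / T) u \<and>
     (\<forall>n. cmod (fc u n) \<le> K' / T \<and> cmod (fc u n) * real_of_int \<bar>n\<bar> ^ Suc p \<le> K' / T * T ^ Suc p)"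
    if T: "T \<ge> 1" for T
  proof -
    obtain u where u: "bump (\<rho> / T) (R / T) u" "\<And>n. cmod (fc u n) \<le> K / T"
        "\<And>n. cmod (fc u n) * real_of_int \<bar>n\<bar> ^ p \<le> K / T * T ^ p"
      using ex[OF T] by blast
    obtain v where v: "bump (\<rho> / T / 2) (R / T + \<rho> / T / 2) v" "\<And>n. cmod (fc v n) \<le> cmod (fc u n)"
        "\<And>n. cmod (fc v n) * real_of_int \<bar>n\<bar> \<le> 4 / (\<rho> / T) * cmod (fc u n)"
      using bump_average[OF u(1)] * T by auto
    have "bump (\<rho> / 2 / T) ((R + \<rho> / 2) / T) v"
      using v(1) by (simp add: add_divide_distrib mult.commute)
    moreover have "cmod (fc v n) \<le> K' / T" for n
    proof -
      have "K / T \<le> K' / T" using T by (intro divide_right_mono) (auto simp: K'_def)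
      then show ?thesis using v(2)[of n] u(2)[of n] by linarith
    qed
    moreover have "cmod (fc v n) * real_of_int \<bar>n\<bar> ^ Suc p \<le> K' / T * T ^ Suc p" for n
    proof -
      have "cmod (fc v n) * real_of_int \<bar>n\<bar> ^ Suc p = (cmod (fc v n) * real_of_int \<bar>n\<bar>) * real_of_int \<bar>n\<bar> ^ p"
        by simp
      also have "\<dots> \<le> 4 / (\<rho> / T) * cmod (fc u n) * real_of_int \<bar>n\<bar> ^ p"
        by (intro mult_right_mono v) auto
      also have "\<dots> = 4 / (\<rho> / T) * (cmod (fc u n) * real_of_int \<bar>n\<bar> ^ p)"
        by simp
      also have "\<dots> \<le> 4 / (\<rho> / T) * (K / T * T ^ p)"
        using * T by (intro mult_left_mono u) auto
      also have "\<dots> = (4 / \<rho> * K) / T * T ^ Suc p"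
        by simp
      also have "\<dots> \<le> K' / T * T ^ Suc p"
        using T by (intro mult_right_mono divide_right_mono) (auto simp: K'_def)
      finally show ?thesis .
    qed
    ultimately show ?thesis by (intro exI[of _ v] conjI allI)
  qed
  moreover have "0 < \<rho> / 2" "\<rho> / 2 \<le> R + \<rho> / 2" "0 \<le> K'"
    using * by (auto simp: K'_def)
  ultimately show ?case
    by (intro exI[of _ "\<rho> / 2"] exI[of _ "R + \<rho> / 2"] exI[of _ K'] conjI allI impI)
qed

text \<open>Each difference gains a factor |n|/T at low frequencies, costs a factor 2 at high ones
  and enlarges the support fivefold. The threshold \<open>T\<^sub>0\<close> guarantees room for the
  disjoint translates. Vanishing to order d at \<open>n = 0\<close>, relative to the scale T, plays
  the part of vanishing moments.\<close>

lemma bump_smooth_oscillating: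
  "\<exists>\<rho> R K T\<^sub>0. 0 < \<rho> \<and> \<rho> \<le> R \<and> 0 \<le> K \<and> 1 \<le> T\<^sub>0 \<and> (\<forall>T\<ge>T\<^sub>0. \<exists>u. bump (\<rho> / T) (R / T) u \<and>
     (\<forall>n. cmod (fc u n) \<le> K / T * (real_of_int \<bar>n\<bar> / T) ^ d \<and>
          cmod (fc u n) * real_of_int \<bar>n\<bar> ^ p \<le> K / T * T ^ p))"
proof (induction d)
  case 0
  obtain \<rho> R K where "0 < \<rho>" "\<rho> \<le> R" "0 \<le> K" "\<forall>T\<ge>1. \<exists>u. bump (\<rho> / T) (R / T) u \<and>
     (\<forall>n. cmod (fc u n) \<le> K / T \<and> cmod (fc u n) * real_of_int \<bar>n\<bar> ^ p \<le> K / T * T ^ p)"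
    using bump_smooth by blast
  then show ?case
    by (intro exI[of _ \<rho>] exI[of _ R] exI[of _ K] exI[of _ "1::real"]) simp
next
  case (Suc d)
  then obtain \<rho> R K T\<^sub>0 where *: "0 < \<rho>" "\<rho> \<le> R" "0 \<le> K" "1 \<le> T\<^sub>0" and
    ex: "\<And>T. T \<ge> T\<^sub>0 \<Longrightarrow> \<exists>u. bump (\<rho> / T) (R / T) u \<and>
     (\<forall>n. cmod (fc u n) \<le> K / T * (real_of_int \<bar>n\<bar> / T) ^ d \<and>
          cmod (fc u n) * real_of_int \<bar>n\<bar> ^ p \<le> K / T * T ^ p)"
    by blast
  define K' where "K' = max (2 * K) (4 * R * K)"
  have "\<exists>u. bump (\<rho> / T) (5 * R / T) u \<and>
     (\<forall>n. cmod (fc u n) \<le> K' / T * (real_of_int \<bar>n\<bar> / T) ^ Suc d \<and>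
          cmod (fc u n) * real_of_int \<bar>n\<bar> ^ p \<le> K' / T * T ^ p)"
    if T: "T \<ge> max T\<^sub>0 (4 * R)" for T
  proof -
    have T1: "T \<ge> T\<^sub>0" "T \<ge> 1" "4 * (R / T) \<le> 1" using T * by auto
    obtain u where u: "bump (\<rho> / T) (R / T) u" "\<And>n. cmod (fc u n) \<le> K / T * (real_of_int \<bar>n\<bar> / T) ^ d"
        "\<And>n. cmod (fc u n) * real_of_int \<bar>n\<bar> ^ p \<le> K / T * T ^ p"
      using ex[OF T1(1)] by blast
    have RT: "\<rho> / T \<le> R / T" "0 < R / T" using * T1 by (auto intro: divide_right_mono)
    obtain v where v: "bump (\<rho> / T) (5 * (R / T)) v" "\<And>n. cmod (fc v n) \<le> 2 * cmod (fc u n)"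
        "\<And>n. cmod (fc v n) \<le> 4 * (R / T) * real_of_int \<bar>n\<bar> * cmod (fc u n)"
      using bump_difference[OF u(1) RT T1(3)] by blast
    have "cmod (fc v n) \<le> K' / T * (real_of_int \<bar>n\<bar> / T) ^ Suc d" for n
    proof -
      have "cmod (fc v n) \<le> 4 * (R / T) * real_of_int \<bar>n\<bar> * (K / T * (real_of_int \<bar>n\<bar> / T) ^ d)"
        using * T1 by (intro order_trans[OF v(3)] mult_left_mono u) auto
      also have "\<dots> = (4 * R * K) / T * (real_of_int \<bar>n\<bar> / T) ^ Suc d"
        by simp
      also have "\<dots> \<le> K' / T * (real_of_int \<bar>n\<bar> / T) ^ Suc d"
        using T1 by (intro mult_right_mono divide_right_mono) (auto simp: K'_def)
      finally show ?thesis .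
    qed
    moreover have "cmod (fc v n) * real_of_int \<bar>n\<bar> ^ p \<le> K' / T * T ^ p" for n
    proof -
      have "cmod (fc v n) * real_of_int \<bar>n\<bar> ^ p \<le> 2 * cmod (fc u n) * real_of_int \<bar>n\<bar> ^ p"
        by (intro mult_right_mono v) auto
      also have "\<dots> \<le> 2 * (K / T * T ^ p)"
        using u(3)[of n] by simp
      also have "\<dots> = (2 * K) / T * T ^ p"
        by simp
      also have "\<dots> \<le> K' / T * T ^ p"
        using T1 by (intro mult_right_mono divide_right_mono) (auto simp: K'_def)
      finally show ?thesis .
    qed
    moreover have "bump (\<rho> / T) (5 * R / T) v" using v(1) by simp
    ultimately show ?thesis by (intro exI[of _ v] conjI allI)
  qed
  moreover have "\<rho> \<le> 5 * R" "0 \<le> K'" "1 \<le> max T\<^sub>0 (4 * R)"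
    using * by (auto simp: K'_def)
  ultimately show ?case using *(1)
    by (intro exI[of _ \<rho>] exI[of _ "5 * R"] exI[of _ K'] exI[of _ "max T\<^sub>0 (4 * R)"] conjI allI impI)
qed

section \<open>Slowly diverging weights\<close>

text \<open>The terms rise geometrically until \<open>q ^ j\<close> passes x and fall geometrically
  afterwards. The induction carries the bound \<open>q ^ J / x\<close> before the peak and
  \<open>4 - 2 * (x / q ^ J)\<close> after it, the subtracted part leaving room for the remaining
  tail. It limits how many scales are felt at one frequency.\<close>

lemma sum_min_geometric_le:
  fixes x q :: real
  assumes x: "x > 0" and q: "q \<ge> 2"
  shows "(\<Sum>j<J. min (x / q ^ j) (q ^ j / x)) \<le> 4"
proof -
  define S where "S = (\<lambda>J. \<Sum>j<J. min (x / q ^ j) (q ^ j / x))"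
  have qp: "q ^ j > 0" for j using q by simp
  have small: "S J \<le> q ^ J / x" for J
  proof (induction J)
    case (Suc J)
    have "S (Suc J) \<le> q ^ J / x + q ^ J / x"
      using Suc by (simp add: S_def)
    also have "\<dots> = 2 * q ^ J / x" by simp
    also have "\<dots> \<le> q ^ Suc J / x"
      using x q qp[of J] by (intro divide_right_mono) auto
    finally show ?case .
  qed (use x in \<open>simp add: S_def\<close>)
  have "q ^ J \<le> x \<or> S J \<le> 4 - 2 * (x / q ^ J)" for J
  proof (induction J)
    case 0
    then show ?case by (auto simp: S_def)
  next
    case (Suc J)
    show ?case
    proof (cases "q ^ Suc J \<le> x")
      case False
      then have lt: "x / q ^ Suc J < 1" using qp[of "Suc J"] by (simp add: field_simps)
      show ?thesis
      proof (cases "q ^ J \<le> x")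
        case True
        then have "q ^ J / x \<le> 1" using x by simp
        moreover have "S (Suc J) \<le> S J + q ^ J / x" by (simp add: S_def)
        ultimately show ?thesis using small[of J] lt by linarith
      next
        case False
        then have "S J \<le> 4 - 2 * (x / q ^ J)" using Suc by simp
        moreover have "S (Suc J) \<le> S J + x / q ^ J" by (simp add: S_def)
        moreover have "2 * (x / q ^ Suc J) \<le> x / q ^ J"
          using q x qp[of J] by (simp add: field_simps)
        ultimately show ?thesis by linarith
      qed
    qed simp
  qed
  moreover have "q ^ J \<le> x \<Longrightarrow> q ^ J / x \<le> 1" "x / q ^ J \<ge> 0"
    using x q by auto
  ultimately have "S J \<le> 4" using small[of J] by fastforce
  then show ?thesis by (simp add: S_def)
qed

text \<open>The terms with n <= T are at most 1 and contribute at most T; beyond T the terms T^2/n^2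
  are dominated by a telescoping sum of total size T.\<close>

lemma sum_min_sq_le:
  assumes T: "T \<ge> (1::nat)"
  shows "(\<Sum>n=1..N. (min (real n / T) (T / real n))\<^sup>2) \<le> 2 * T"
proof -
  define S where "S = (\<lambda>N. \<Sum>n=1..N. (min (real n / T) (T / real n))\<^sup>2)"
  have "S N \<le> (if N \<le> T then real N else 2 * T - (real T)\<^sup>2 / N)" for N
  proof (induction N)
    case (Suc N)
    have step: "S (Suc N) = S N + (min (real (Suc N) / T) (T / real (Suc N)))\<^sup>2"
      by (simp add: S_def)
    show ?case
    proof (cases "Suc N \<le> T")
      case True
      have "min (real (Suc N) / T) (T / real (Suc N)) \<le> 1"
        using True T by (intro min.coboundedI1) (simp add: field_simps)
      then have "(min (real (Suc N) / T) (T / real (Suc N)))\<^sup>2 \<le> 1\<^sup>2"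
        by (intro power_mono) auto
      then show ?thesis using step Suc True by simp
    next
      case False
      then have N: "N \<ge> 1" "N \<ge> T" using T by auto
      have "S N \<le> 2 * T - (real T)\<^sup>2 / N"
      proof (cases "N = T")
        case True
        then show ?thesis using Suc T by (simp add: power2_eq_square)
      qed (use Suc N in simp)
      moreover have "(min (real (Suc N) / T) (T / real (Suc N)))\<^sup>2 \<le> (T / real (Suc N))\<^sup>2"
        by (intro power_mono) auto
      moreover have "(T / real (Suc N))\<^sup>2 \<le> (real T)\<^sup>2 / N - (real T)\<^sup>2 / Suc N"
      proof -
        have "(real T)\<^sup>2 / N - (real T)\<^sup>2 / Suc N = (real T)\<^sup>2 / (real N * real (Suc N))"
          using N by (simp add: field_simps)
        also have "\<dots> \<ge> (real T)\<^sup>2 / (real (Suc N) * real (Suc N))"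
          using N by (intro divide_left_mono mult_right_mono) auto
        finally show ?thesis by (simp add: power2_eq_square)
      qed
      ultimately have "S (Suc N) \<le> 2 * T - (real T)\<^sup>2 / Suc N" using step by linarith
      then show ?thesis using False by simp
    qed
  qed (simp add: S_def)
  from this[of N] have "S N \<le> 2 * T"
    by (auto split: if_splits intro: order_trans)
  then show ?thesis by (simp add: S_def)
qed

lemma sum_int_le:
  fixes g :: "nat \<Rightarrow> real"
  assumes F: "finite F" and g: "\<And>n. g n \<ge> 0" and S: "\<And>N. (\<Sum>n=1..N. g n) \<le> S"
  shows "(\<Sum>n\<in>F. g (nat \<bar>n\<bar>)) \<le> g 0 + 2 * S"
proof -
  define N where "N = Max (insert 1 ((\<lambda>n. nat \<bar>n\<bar>) ` F))"
  have N: "nat \<bar>n\<bar> \<le> N" if "n \<in> F" for n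
    unfolding N_def using F that by (intro Max_ge) auto
  have half: "(\<Sum>n\<in>A. g (nat \<bar>n\<bar>)) \<le> S" if "A \<subseteq> F" "inj_on (\<lambda>n. nat \<bar>n\<bar>) A" "0 \<notin> A" for A
  proof -
    have "(\<Sum>n\<in>A. g (nat \<bar>n\<bar>)) = (\<Sum>n\<in>(\<lambda>n. nat \<bar>n\<bar>) ` A. g n)"
      using that by (simp add: sum.reindex)
    also have "\<dots> \<le> (\<Sum>n=1..N. g n)"
    proof (rule sum_mono2)
      show "(\<lambda>n. nat \<bar>n\<bar>) ` A \<subseteq> {1..N}"
      proof
        fix k assume "k \<in> (\<lambda>n. nat \<bar>n\<bar>) ` A"
        then obtain n where n: "n \<in> A" "k = nat \<bar>n\<bar>" by blast
        then have "n \<noteq> 0" using that by blast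
        then show "k \<in> {1..N}" using n N[of n] that by auto
      qed
    qed (use g in auto)
    finally show ?thesis using S[of N] by linarith
  qed
  have "F = (F \<inter> {0}) \<union> ((F \<inter> {0<..}) \<union> (F \<inter> {..<0}))" by auto
  then have "(\<Sum>n\<in>F. g (nat \<bar>n\<bar>)) = (\<Sum>n\<in>(F \<inter> {0}) \<union> ((F \<inter> {0<..}) \<union> (F \<inter> {..<0})). g (nat \<bar>n\<bar>))"
    by simp
  also have "\<dots> = (\<Sum>n\<in>F \<inter> {0}. g (nat \<bar>n\<bar>)) + ((\<Sum>n\<in>F \<inter> {0<..}. g (nat \<bar>n\<bar>)) + (\<Sum>n\<in>F \<inter> {..<0}. g (nat \<bar>n\<bar>)))"
    using F by (subst sum.union_disjoint; (subst sum.union_disjoint)?) auto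
  also have "\<dots> \<le> g 0 + (S + S)"
  proof (intro add_mono half)
    show "(\<Sum>n\<in>F \<inter> {0}. g (nat \<bar>n\<bar>)) \<le> g 0"
      using g[of 0] by (cases "0 \<in> F") auto
  qed (auto simp: inj_on_def)
  finally show ?thesis by simp
qed

context moderate_weight
begin

text \<open>A decay of order \<open>a + 2\<close> against the growth of order a in
  \<open>multiplierI\<close> leaves a constant times 1/l^2.\<close>

lemma multiplier_decay:
  assumes P: "continuous_on unit_circle P"
    and B: "\<And>n. cmod (fourier_coeff P n) * real_of_int \<bar>n\<bar> ^ (a + 2) \<le> B"
  shows "multiplier w P"
proof (rule multiplierI[OF P])
  fix F :: "int set" assume F: "finite F"
  have B0: "B \<ge> 0" using B[of 0] by simp
  define c where "c = cmod (fourier_coeff P 0)"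
  \<comment> \<open>This is \<open>sum_min_sq_le\<close> at scale 1, where the kernel is 1/n for n
    >= 1 and 0 at n = 0; the zeroth coefficient is therefore added separately.\<close>
  define g where "g = (\<lambda>n::nat. (if n = 0 then c else 0) + 2 ^ a * B * (min (real n / real (1::nat)) (real (1::nat) / real n))\<^sup>2)"
  have "cmod (fourier_coeff P l) * (1 + real_of_int \<bar>l\<bar>) ^ a \<le> g (nat \<bar>l\<bar>)" for l
  proof (cases "l = 0")
    case False
    define x where "x = real_of_int \<bar>l\<bar>"
    have x: "x \<ge> 1" using False by (simp add: x_def)
    have "cmod (fourier_coeff P l) \<le> B / x ^ (a + 2)"
      using B[of l] x by (simp add: x_def field_simps)
    then have "cmod (fourier_coeff P l) * (1 + x) ^ a \<le> B / x ^ (a + 2) * (2 * x) ^ a"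
      using x B0 by (intro mult_mono power_mono) auto
    also have "\<dots> = 2 ^ a * B * (1 / x)\<^sup>2"
      using x by (simp add: power_mult_distrib power_add power2_eq_square field_simps)
    also have "1 / x = min (x / 1) (1 / x)"
      using x by (auto simp: min_def field_simps) (use mult_mono[of 1 x 1 x] in auto)
    finally show ?thesis
      using False by (simp add: g_def x_def)
  qed (use B0 in \<open>simp add: g_def c_def\<close>)
  then have "(\<Sum>l\<in>F. cmod (fourier_coeff P l) * (1 + real_of_int \<bar>l\<bar>) ^ a) \<le> (\<Sum>l\<in>F. g (nat \<bar>l\<bar>))"
    by (rule sum_mono)
  also have "\<dots> \<le> g 0 + 2 * (2 ^ a * B * 2)"
  proof (rule sum_int_le[OF F])
    fix N
    have "(\<Sum>n=1..N. g n) = 2 ^ a * B * (\<Sum>n=1..N. (min (real n / real (1::nat)) (real (1::nat) / real n))\<^sup>2)"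
      unfolding sum_distrib_left by (intro sum.cong) (auto simp: g_def)
    also have "\<dots> \<le> 2 ^ a * B * (2 * real (1::nat))"
      by (intro mult_left_mono sum_min_sq_le) (use B0 in auto)
    finally show "(\<Sum>n=1..N. g n) \<le> 2 ^ a * B * 2" by simp
  qed (use B0 in \<open>auto simp: g_def c_def\<close>)
  finally show "(\<Sum>l\<in>F. cmod (fourier_coeff P l) * (1 + real_of_int \<bar>l\<bar>) ^ a) \<le> g 0 + 2 * (2 ^ a * B * 2)" .
qed

end

section \<open>Power bounds from the doubling condition\<close>

text \<open>Going from n to m takes about log_2(m/n) doublings, each costing a factor C, and C < 2^a
  converts the product into a power of m/n. The extra factor C pays for rounding the number of
  doublings up.\<close>

lemma doubling_power_bound:
  fixes lam :: "nat \<Rightarrow> real"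
  assumes pos: "\<And>n. lam n > 0" and C: "C > 1"
    and doubling: "\<And>n k. n \<ge> 1 \<Longrightarrow> n \<le> k \<Longrightarrow> k \<le> 2 * n \<Longrightarrow> inverse C * lam n \<le> lam k \<and> lam k \<le> C * lam n"
  obtains a :: nat where "\<And>m n. 1 \<le> n \<Longrightarrow> n \<le> m \<Longrightarrow>
    lam m \<le> C * (real m / n) ^ a * lam n \<and> lam n \<le> C * (real m / n) ^ a * lam m"
proof -
  obtain a :: nat where a: "C < 2 ^ a"
    using real_arch_pow[of 2 C] by auto
  have iter: "lam m \<le> C ^ i * lam n \<and> lam n \<le> C ^ i * lam m"
    if "1 \<le> n" "n \<le> m" "m \<le> 2 ^ i * n" for i m n
    using that
  proof (induction i arbitrary: m)
    case 0
    then show ?case by simp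
  next
    case (Suc i)
    \<comment> \<open>The intermediate index is half of m, rounded up so that one doubling still
      reaches m, and kept at least n.\<close>
    define k where "k = max n ((m + 1) div 2)"
    have k: "n \<le> k" "k \<le> 2 ^ i * n" "k \<le> m" "m \<le> 2 * k"
      using Suc.prems by (auto simp: k_def)
    have IH: "lam k \<le> C ^ i * lam n" "lam n \<le> C ^ i * lam k"
      using Suc.IH[of k] Suc.prems k by auto
    have d: "inverse C * lam k \<le> lam m" "lam m \<le> C * lam k"
      using doubling[of k m] Suc.prems k by auto
    have "lam m \<le> C * (C ^ i * lam n)"
      using d(2) IH(1) C by (meson less_trans mult_le_cancel_left_pos order_trans zero_less_one)
    moreover have "lam k \<le> C * lam m"
      using d(1) C by (simp add: field_simps)
    then have "lam n \<le> C ^ i * (C * lam m)"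
      using IH(2) C by (meson less_trans mult_le_cancel_left_pos order_trans zero_less_one zero_less_power)
    ultimately show ?case by (simp add: mult_ac)
  qed
  show ?thesis
  proof
    fix m n :: nat assume mn: "1 \<le> n" "n \<le> m"
    have "m \<le> 2 ^ m * n"
      using mn less_exp[of m] mult_le_mono[of m "2 ^ m" 1 n] by simp
    then have ex: "\<exists>i. m \<le> 2 ^ i * n" by blast
    define i where "i = (LEAST i. m \<le> 2 ^ i * n)"
    have i: "m \<le> 2 ^ i * n" unfolding i_def by (rule LeastI_ex[OF ex])
    have "C ^ i \<le> C * (real m / n) ^ a"
    proof (cases i)
      case 0
      have "1 \<le> (real m / n) ^ a" using mn by (intro one_le_power) simp
      then have "1 * 1 \<le> C * (real m / n) ^ a" using C by (intro mult_mono) auto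
      then show ?thesis using 0 by simp
    next
      case (Suc j)
      then have "\<not> m \<le> 2 ^ j * n"
        using not_less_Least[of j "\<lambda>i. m \<le> 2 ^ i * n"] by (simp add: i_def)
      then have "real (2 ^ j * n) \<le> real m" by (metis nat_le_linear of_nat_le_iff)
      then have j: "2 ^ j \<le> real m / n" using mn by (simp add: field_simps)
      have "C ^ j \<le> (2 ^ a) ^ j" using a C by (intro power_mono) auto
      also have "\<dots> = (2 ^ j) ^ a" by (simp add: mult.commute flip: power_mult)
      also have "\<dots> \<le> (real m / n) ^ a" using j by (intro power_mono) auto
      finally show ?thesis using Suc C by simp
    qed
    then have "C ^ i * lam k \<le> C * (real m / n) ^ a * lam k" for k
      using pos[of k] by (intro mult_right_mono) auto
    then show "lam m \<le> C * (real m / n) ^ a * lam n \<and> lam n \<le> C * (real m / n) ^ a * lam m"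
      using iter[OF mn i] order_trans by blast
  qed
qed

text \<open>
  The minimum in \<open>scaling\<close>, which also occurs in the estimates below, vanishes at \<open>n = 0\<close> because \<open>T / 0 = 0\<close>.
\<close>

locale slow_weight = moderate_weight +
  assumes scaling: "n \<noteq> 0 \<Longrightarrow> 1 \<le> T \<Longrightarrow>
      w n * (min (real_of_int \<bar>n\<bar> / real T) (real T / real_of_int \<bar>n\<bar>)) ^ a \<le> L * w (int T)"
    and divergent: "2 \<le> q \<Longrightarrow> \<not> summable (\<lambda>j. 1 / (1 + w (int (q ^ j)) / real (q ^ j)))"
begin

text \<open>Of the \<open>2 * (a + 1)\<close> factors \<kappa>, a of them bring \<open>w n\<close>
  down to the weight at T by \<open>scaling\<close>, another a are discarded as at most 1, and the
  last two are summed over n to a multiple of T.\<close>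

lemma weight_sum_le:
  assumes T: "1 \<le> T" and F: "finite F"
  defines "\<kappa> \<equiv> \<lambda>n. min (real_of_int \<bar>n\<bar> / real T) (real T / real_of_int \<bar>n\<bar>)"
  shows "(\<Sum>n\<in>F. w n * \<kappa> n ^ (2 * (a + 1))) \<le> 4 * L * w (int T) * T"
proof -
  have k0: "0 \<le> \<kappa> n" for n by (simp add: \<kappa>_def)
  have k1: "\<kappa> n \<le> 1" for n
    using T by (cases "real_of_int \<bar>n\<bar> \<le> real T") (auto simp: \<kappa>_def min_le_iff_disj)
  have "w n * \<kappa> n ^ (2 * (a + 1)) \<le> L * w (int T) * (\<kappa> n)\<^sup>2" for n
  proof (cases "n = 0")
    case False
    have "w n * \<kappa> n ^ (2 * (a + 1)) = (w n * \<kappa> n ^ a) * \<kappa> n ^ a * (\<kappa> n)\<^sup>2"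
      by (simp add: power_add power_mult power2_eq_square power_mult_distrib)
    also have "\<dots> \<le> (L * w (int T)) * 1 * (\<kappa> n)\<^sup>2"
    proof (rule mult_right_mono, rule mult_mono)
      show "w n * \<kappa> n ^ a \<le> L * w (int T)"
        using scaling[OF False T] by (simp only: \<kappa>_def)
      show "\<kappa> n ^ a \<le> 1" "0 \<le> \<kappa> n ^ a"
        using k0[of n] k1[of n] by (simp_all add: power_le_one)
      show "0 \<le> L * w (int T)" "0 \<le> (\<kappa> n)\<^sup>2"
        using L_ge_1 pos[of "int T"] by simp_all
    qed
    finally show ?thesis by simp
  qed (simp add: \<kappa>_def)
  then have "(\<Sum>n\<in>F. w n * \<kappa> n ^ (2 * (a + 1))) \<le> L * w (int T) * (\<Sum>n\<in>F. (\<kappa> n)\<^sup>2)"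
    unfolding sum_distrib_left by (rule sum_mono)
  also have "(\<Sum>n\<in>F. (\<kappa> n)\<^sup>2) \<le> 0 + 2 * (2 * T)"
    using sum_int_le[OF F, of "\<lambda>n. (min (real n / T) (T / real n))\<^sup>2", OF _ sum_min_sq_le[OF T]]
    by (simp add: \<kappa>_def)
  finally show ?thesis
    using L_ge_1 pos[of "int T"] by (simp add: mult_ac)
qed

section \<open>Averages of bumps over many scales\<close>

text \<open>Almost orthogonality of the scales. A coefficient of \<open>u j\<close> is at most K
  \<kappa>_j^(a+2)/q^j. One factor \<kappa>_j is split off for Cauchy-Schwarz over j, where it costs
  only the constant 4; the square of the rest is what \<open>weight_sum_le\<close> sums over n.
  Hence 16 = 4 * 4.\<close>

lemma weighted_norm_bumps_le:
  fixes u :: "nat \<Rightarrow> complex \<Rightarrow> real" and q :: nat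
  assumes q: "2 \<le> q" and I: "finite I" and K: "K \<ge> 0" and \<alpha>: "\<And>j. j \<in> I \<Longrightarrow> \<alpha> j \<ge> 0"
    and c: "\<And>j. j \<in> I \<Longrightarrow> continuous_on unit_circle (u j)"
    and u1: "\<And>j n. j \<in> I \<Longrightarrow> cmod (fc (u j) n) \<le> K / real q ^ j * (real_of_int \<bar>n\<bar> / real q ^ j) ^ (a + 2)"
    and u2: "\<And>j n. j \<in> I \<Longrightarrow> cmod (fc (u j) n) * real_of_int \<bar>n\<bar> ^ (a + 2) \<le> K / real q ^ j * (real q ^ j) ^ (a + 2)"
  shows "weighted_norm_le w (\<lambda>z. complex_of_real (\<Sum>j\<in>I. \<alpha> j * u j z))
    (sqrt (16 * K\<^sup>2 * L * (\<Sum>j\<in>I. (\<alpha> j)\<^sup>2 * (w (int (q ^ j)) / real q ^ j))))"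
  unfolding weighted_norm_le_def
proof (intro allI impI)
  fix F :: "int set" assume F: "finite F"
  define T where "T = (\<lambda>j. real q ^ j)"
  have T: "T j > 0" for j using q by (simp add: T_def)
  define \<kappa> where "\<kappa> = (\<lambda>j n. min (real_of_int \<bar>n\<bar> / T j) (T j / real_of_int \<bar>n\<bar>))"
  have k0: "0 \<le> \<kappa> j n" for j n using T[of j] by (simp add: \<kappa>_def)
  have k1: "\<kappa> j n \<le> 1" for j n
    using T[of j] by (cases "real_of_int \<bar>n\<bar> \<le> T j") (auto simp: \<kappa>_def min_le_iff_disj)
  \<comment> \<open>At \<open>n = 0\<close> the kernel is 0 by the convention for division, and
    \<open>u1\<close> makes the coefficient 0 as well.\<close>
  have uk: "cmod (fc (u j) n) \<le> K / T j * \<kappa> j n ^ (a + 2)" if j: "j \<in> I" for j n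
  proof (cases "n = 0")
    case True
    then show ?thesis using u1[OF j, of n] T[of j] by (simp add: \<kappa>_def T_def)
  next
    case False
    have "cmod (fc (u j) n) \<le> K / T j * (T j / real_of_int \<bar>n\<bar>) ^ (a + 2)"
      using u2[OF j, of n] False by (simp add: T_def power_divide pos_le_divide_eq)
    moreover have "cmod (fc (u j) n) \<le> K / T j * (real_of_int \<bar>n\<bar> / T j) ^ (a + 2)"
      using u1[OF j, of n] by (simp only: T_def)
    moreover have "\<kappa> j n = real_of_int \<bar>n\<bar> / T j \<or> \<kappa> j n = T j / real_of_int \<bar>n\<bar>"
      by (simp add: \<kappa>_def min_def)
    ultimately show ?thesis by (elim disjE) (simp_all only:)
  qed
  have coef: "w n * (cmod (fc (\<lambda>z. \<Sum>j\<in>I. \<alpha> j * u j z) n))\<^sup>2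
      \<le> (\<Sum>j\<in>I. 4 * (\<alpha> j * K / T j)\<^sup>2 * (w n * \<kappa> j n ^ (2 * (a + 1))))" for n
  proof -
    have "fc (\<lambda>z. \<Sum>j\<in>I. \<alpha> j * u j z) n = (\<Sum>j\<in>I. \<alpha> j * fc (u j) n)"
      unfolding of_real_sum of_real_mult fourier_coeff_cmult[symmetric]
      by (rule fourier_coeff_sum) (intro continuous_intros c)
    then have "cmod (fc (\<lambda>z. \<Sum>j\<in>I. \<alpha> j * u j z) n) \<le> (\<Sum>j\<in>I. cmod (\<alpha> j * fc (u j) n))"
      by (simp add: norm_sum)
    also have "\<dots> \<le> (\<Sum>j\<in>I. (\<alpha> j * K / T j * \<kappa> j n ^ (a + 1)) * \<kappa> j n)"
    proof (rule sum_mono)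
      fix j assume j: "j \<in> I"
      have "cmod (\<alpha> j * fc (u j) n) \<le> \<alpha> j * (K / T j * \<kappa> j n ^ (a + 2))"
        using mult_left_mono[OF uk[OF j, of n] \<alpha>[OF j]] \<alpha>[OF j]
        by (simp only: norm_mult norm_of_real abs_of_nonneg)
      then show "cmod (\<alpha> j * fc (u j) n) \<le> (\<alpha> j * K / T j * \<kappa> j n ^ (a + 1)) * \<kappa> j n"
        by (simp add: mult_ac)
    qed
    finally have "(cmod (fc (\<lambda>z. \<Sum>j\<in>I. \<alpha> j * u j z) n))\<^sup>2
        \<le> (\<Sum>j\<in>I. (\<alpha> j * K / T j * \<kappa> j n ^ (a + 1)) * \<kappa> j n)\<^sup>2"
      by (intro power_mono) auto
    also have "\<dots> \<le> (\<Sum>j\<in>I. (\<alpha> j * K / T j * \<kappa> j n ^ (a + 1))\<^sup>2) * (\<Sum>j\<in>I. (\<kappa> j n)\<^sup>2)"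
      by (rule Cauchy_Schwarz_ineq_sum)
    also have "\<dots> \<le> (\<Sum>j\<in>I. (\<alpha> j * K / T j * \<kappa> j n ^ (a + 1))\<^sup>2) * 4"
    proof (rule mult_left_mono)
      show "(\<Sum>j\<in>I. (\<kappa> j n)\<^sup>2) \<le> 4"
      proof (cases "n = 0")
        case True
        then show ?thesis by (simp add: \<kappa>_def)
      next
        case False
        have "(\<Sum>j\<in>I. (\<kappa> j n)\<^sup>2) \<le> (\<Sum>j\<in>I. \<kappa> j n)"
          using k0 k1 by (intro sum_mono) (simp add: power2_eq_square mult_left_le)
        also have "\<dots> \<le> (\<Sum>j<Suc (Max (insert 0 I)). \<kappa> j n)"
          using I k0 by (intro sum_mono2) (auto simp: less_Suc_eq_le)
        also have "\<dots> \<le> 4"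
          unfolding \<kappa>_def T_def by (rule sum_min_geometric_le) (use q False in auto)
        finally show ?thesis .
      qed
    qed (simp add: sum_nonneg)
    finally have "w n * (cmod (fc (\<lambda>z. \<Sum>j\<in>I. \<alpha> j * u j z) n))\<^sup>2
        \<le> w n * ((\<Sum>j\<in>I. (\<alpha> j * K / T j * \<kappa> j n ^ (a + 1))\<^sup>2) * 4)"
      using pos[of n] by (intro mult_left_mono) auto
    also have "\<dots> = (\<Sum>j\<in>I. 4 * (\<alpha> j * K / T j)\<^sup>2 * (w n * \<kappa> j n ^ (2 * (a + 1))))"
      unfolding sum_distrib_left sum_distrib_right
    proof (rule sum.cong)
      fix j
      have "\<kappa> j n ^ (2 * (a + 1)) = (\<kappa> j n ^ (a + 1))\<^sup>2"
        by (metis mult.commute power_mult)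
      then show "w n * ((\<alpha> j * K / T j * \<kappa> j n ^ (a + 1))\<^sup>2 * 4)
          = 4 * (\<alpha> j * K / T j)\<^sup>2 * (w n * \<kappa> j n ^ (2 * (a + 1)))"
        by (simp only: power_mult_distrib mult_ac)
    qed simp
    finally show ?thesis .
  qed
  have "(\<Sum>n\<in>F. w n * (cmod (fc (\<lambda>z. \<Sum>j\<in>I. \<alpha> j * u j z) n))\<^sup>2)
      \<le> (\<Sum>n\<in>F. \<Sum>j\<in>I. 4 * (\<alpha> j * K / T j)\<^sup>2 * (w n * \<kappa> j n ^ (2 * (a + 1))))"
    by (intro sum_mono coef)
  also have "\<dots> = (\<Sum>j\<in>I. 4 * (\<alpha> j * K / T j)\<^sup>2 * (\<Sum>n\<in>F. w n * \<kappa> j n ^ (2 * (a + 1))))"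
    by (subst sum.swap) (simp add: sum_distrib_left)
  also have "\<dots> \<le> (\<Sum>j\<in>I. 4 * (\<alpha> j * K / T j)\<^sup>2 * (4 * L * w (int (q ^ j)) * T j))"
  proof (intro sum_mono mult_left_mono)
    fix j
    show "(\<Sum>n\<in>F. w n * \<kappa> j n ^ (2 * (a + 1))) \<le> 4 * L * w (int (q ^ j)) * T j"
      using weight_sum_le[of "q ^ j" F] F q by (simp add: \<kappa>_def T_def)
  qed auto
  also have "\<dots> = 16 * K\<^sup>2 * L * (\<Sum>j\<in>I. (\<alpha> j)\<^sup>2 * (w (int (q ^ j)) / real q ^ j))"
    unfolding sum_distrib_left
  proof (rule sum.cong)
    fix j
    show "4 * (\<alpha> j * K / T j)\<^sup>2 * (4 * L * w (int (q ^ j)) * T j)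
        = 16 * K\<^sup>2 * L * ((\<alpha> j)\<^sup>2 * (w (int (q ^ j)) / real q ^ j))"
      using T[of j] by (simp add: T_def[symmetric] power2_eq_square field_simps)
  qed simp
  finally show "weighted_norm w F (\<lambda>z. complex_of_real (\<Sum>j\<in>I. \<alpha> j * u j z))
      \<le> sqrt (16 * K\<^sup>2 * L * (\<Sum>j\<in>I. (\<alpha> j)\<^sup>2 * (w (int (q ^ j)) / real q ^ j)))"
    unfolding weighted_norm_def L2_set_def power_mult_distrib
    using pos by (simp add: less_imp_le)
qed

text \<open>
  The supports of the bumps are nested inside the plateaus of the previous ones, so at each point
  at most one of them is negative.
\<close>

lemma nested_bumps_sum:
  fixes u :: "nat \<Rightarrow> complex \<Rightarrow> real" and q :: nat and R \<rho> \<delta> :: real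
  assumes I: "finite I" and q: "1 \<le> q" "R \<le> \<rho> * q" and \<rho>: "0 < \<rho>"
    and u: "\<And>j. j \<in> I \<Longrightarrow> bump (\<rho> / real q ^ j) (R / real q ^ j) (u j)"
    and \<alpha>: "\<And>j. j \<in> I \<Longrightarrow> 0 \<le> \<alpha> j" "\<And>j. j \<in> I \<Longrightarrow> \<alpha> j \<le> \<delta>" "0 \<le> \<delta>"
    and z: "z \<in> unit_circle"
  shows "- \<delta> \<le> (\<Sum>j\<in>I. \<alpha> j * u j z)"
proof (cases "\<exists>i\<in>I. u i z < 0")
  case False
  then have "0 \<le> (\<Sum>j\<in>I. \<alpha> j * u j z)"
    using \<alpha> by (intro sum_nonneg mult_nonneg_nonneg) (auto simp: not_less)
  then show ?thesis using \<alpha> by linarith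
next
  case True
  then obtain i where i: "i \<in> I" "u i z < 0" by blast
  have qp: "real q ^ j > 0" for j using q by simp
  \<comment> \<open>A negative value of bump i places z strictly between its plateau and the edge of
    its support. There all coarser bumps are 1 and all finer ones are 0.\<close>
  have far: "\<rho> / real q ^ i < cmod (z - 1)" and near: "cmod (z - 1) < R / real q ^ i"
    by (rule ccontr, use u[OF i(1)] z i(2) in \<open>simp add: bump_def not_less\<close>)+
  have step: "R / real q ^ k \<le> \<rho> / real q ^ j" if "j < k" for j k
  proof -
    have "real q ^ Suc j \<le> real q ^ k" using q that by (intro power_increasing) auto
    then have "\<rho> * q * real q ^ j \<le> \<rho> * real q ^ k" using \<rho> by (simp add: mult.assoc)
    moreover have "R * real q ^ j \<le> \<rho> * q * real q ^ j" using q by (intro mult_right_mono) auto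
    ultimately have "R * real q ^ j \<le> \<rho> * real q ^ k" by linarith
    then show ?thesis using qp by (simp add: divide_le_eq le_divide_eq mult.commute)
  qed
  have nonneg: "0 \<le> u j z" if j: "j \<in> I" "j \<noteq> i" for j
  proof (cases "j < i")
    case True
    then have "u j z = 1" using step[OF True] near u[OF j(1)] z by (auto simp: bump_def)
    then show ?thesis by simp
  next
    case False
    then have "i < j" using j by simp
    then have "u j z = 0" using step[OF \<open>i < j\<close>] far u[OF j(1)] z by (auto simp: bump_def)
    then show ?thesis by simp
  qed
  have "\<alpha> i * (- 1) \<le> \<alpha> i * u i z"
    using u[OF i(1)] z \<alpha>(1)[OF i(1)] by (intro mult_left_mono) (auto simp: bump_def abs_le_iff)
  then have "- \<delta> \<le> \<alpha> i * u i z" using \<alpha>(2)[OF i(1)] by linarith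
  moreover have "0 \<le> (\<Sum>j\<in>I - {i}. \<alpha> j * u j z)"
    using \<alpha> nonneg by (intro sum_nonneg mult_nonneg_nonneg) auto
  ultimately show ?thesis using I i(1) by (simp add: sum.remove)
qed

lemma weighted_norm_const_le:
  assumes F: "finite F"
  shows "weighted_norm w F (\<lambda>z. c) \<le> sqrt (w 0) * cmod c"
proof -
  have "weighted_norm w F (\<lambda>z. c) = sqrt (\<Sum>n\<in>F. if n = 0 then w 0 * (cmod c)\<^sup>2 else 0)"
    unfolding weighted_norm_def L2_set_def fourier_coeff_const power_mult_distrib
    using pos by (intro arg_cong[where f=sqrt] sum.cong) (auto simp: less_imp_le)
  also have "\<dots> \<le> sqrt (w 0 * (cmod c)\<^sup>2)"
    using F pos[of 0] by (intro real_sqrt_le_mono) auto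
  finally show ?thesis by (simp add: real_sqrt_mult)
qed

text \<open>One quantity \<open>1 / B\<close>, with B a large partial sum of the divergent series,
  controls everything: the squared norm of the average \<open>G\<close> is at most a constant times
  it, and so is its negative part. The decay constant may depend on all choices, since it only has
  to make \<open>1 - H\<close> a multiplier.\<close>

lemma flat_function_exists:
  assumes \<epsilon>: "\<epsilon> > 0"
  obtains H \<rho> B where "\<rho> > 0" "continuous_on unit_circle H"
    "\<And>z. z \<in> unit_circle \<Longrightarrow> 0 \<le> H z \<and> H z \<le> 1"
    "\<And>z. z \<in> unit_circle \<Longrightarrow> cmod (z - 1) \<le> \<rho> \<Longrightarrow> H z = 1"
    "weighted_norm_le w (\<lambda>z. complex_of_real (H z)) \<epsilon>"
    "\<And>n. cmod (fc H n) * real_of_int \<bar>n\<bar> ^ (a + 2) \<le> B"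
proof -
  obtain \<rho> R K T\<^sub>0 where *: "0 < \<rho>" "\<rho> \<le> R" "0 \<le> K" "1 \<le> T\<^sub>0" and
    ex: "\<And>T. T \<ge> T\<^sub>0 \<Longrightarrow> \<exists>u. bump (\<rho> / T) (R / T) u \<and>
     (\<forall>n. cmod (fc u n) \<le> K / T * (real_of_int \<bar>n\<bar> / T) ^ (a + 2) \<and>
          cmod (fc u n) * real_of_int \<bar>n\<bar> ^ (a + 2) \<le> K / T * T ^ (a + 2))"
    using bump_smooth_oscillating[where d="a + 2" and p="a + 2"] by blast
  \<comment> \<open>The ratio 2 serves the geometric sums over scales; \<open>R / \<rho>\<close>
    makes each support fit into the preceding plateau.\<close>
  obtain q :: nat where q: "real q \<ge> max 2 (R / \<rho>)"
    using real_arch_simple by blast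
  then have q2: "q \<ge> 2" and qR: "R \<le> \<rho> * q"
    using * by (auto simp: field_simps)
  have qp: "real q ^ j > 0" for j using q2 by simp
  obtain j\<^sub>0 where j0: "T\<^sub>0 < real q ^ j\<^sub>0"
    using real_arch_pow[of q T\<^sub>0] q2 by auto
  define good where "good = (\<lambda>j u. bump (\<rho> / real q ^ j) (R / real q ^ j) u \<and>
     (\<forall>n. cmod (fc u n) \<le> K / real q ^ j * (real_of_int \<bar>n\<bar> / real q ^ j) ^ (a + 2) \<and>
          cmod (fc u n) * real_of_int \<bar>n\<bar> ^ (a + 2) \<le> K / real q ^ j * (real q ^ j) ^ (a + 2)))"
  \<comment> \<open>The implication makes the choice of \<open>u\<close> total, although bumps are
    available only from scale \<open>T\<^sub>0\<close> on.\<close>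
  have "\<exists>u. j \<ge> j\<^sub>0 \<longrightarrow> good j u" for j
  proof (cases "j \<ge> j\<^sub>0")
    case True
    then have "real q ^ j\<^sub>0 \<le> real q ^ j" using q2 by (intro power_increasing) auto
    then show ?thesis using ex[of "real q ^ j"] j0 unfolding good_def by simp
  qed simp
  then obtain u where good: "\<And>j. j \<ge> j\<^sub>0 \<Longrightarrow> good j (u j)" by metis
  then have u: "\<And>j. j \<ge> j\<^sub>0 \<Longrightarrow> bump (\<rho> / real q ^ j) (R / real q ^ j) (u j)"
    and u1: "\<And>j n. j \<ge> j\<^sub>0 \<Longrightarrow> cmod (fc (u j) n) \<le> K / real q ^ j * (real_of_int \<bar>n\<bar> / real q ^ j) ^ (a + 2)"
    and u2: "\<And>j n. j \<ge> j\<^sub>0 \<Longrightarrow> cmod (fc (u j) n) * real_of_int \<bar>n\<bar> ^ (a + 2) \<le> K / real q ^ j * (real q ^ j) ^ (a + 2)"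
    unfolding good_def by blast+
  define x where "x = (\<lambda>j. w (int (q ^ j)) / real (q ^ j))"
  have x: "x j > 0" for j using pos qp[of j] by (simp add: x_def)
  \<comment> \<open>Comparable to min(1, 1/x): the term 1/x is optimal for the norm, since then b^2
    x is about b, and the cap at 1 makes every normalized coefficient at most
    \<open>1 / B\<close>.\<close>
  define b where "b = (\<lambda>j. 1 / (1 + x j))"
  have b: "0 < b j" "b j \<le> 1" "b j * x j \<le> 1" for j
    using x[of j] by (auto simp: b_def field_simps)
  \<comment> \<open>The three summands ensure B >= 1, norm at most \<epsilon>/2 for the average
    \<open>G\<close>, and norm at most \<epsilon>/2 for the constant \<delta> = 1/B.\<close>
  define M where "M = 1 + 64 * K\<^sup>2 * L / \<epsilon>\<^sup>2 + 2 * sqrt (w 0) / \<epsilon>"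
  have MK: "64 * K\<^sup>2 * L / \<epsilon>\<^sup>2 \<le> M" and Mw: "2 * sqrt (w 0) / \<epsilon> \<le> M" and M1: "1 \<le> M"
    using \<epsilon> L_ge_1 pos[of 0] by (auto simp: M_def)
  have "\<exists>J. M \<le> (\<Sum>j\<in>{j\<^sub>0..<J}. b j)"
  proof (rule ccontr)
    assume neg: "\<nexists>J. M \<le> (\<Sum>j\<in>{j\<^sub>0..<J}. b j)"
    have "summable (\<lambda>j. b (j + j\<^sub>0))"
    proof (rule bounded_imp_summable[where B=M])
      fix J
      have "(\<Sum>j\<le>J. b (j + j\<^sub>0)) = (\<Sum>j\<in>{j\<^sub>0..<Suc J + j\<^sub>0}. b j)"
        using sum.shift_bounds_nat_ivl[of b 0 j\<^sub>0 "Suc J"] by (simp add: atLeast0LessThan lessThan_Suc_atMost)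
      then show "(\<Sum>j\<le>J. b (j + j\<^sub>0)) \<le> M" using neg by (metis linear)
    qed (use b in \<open>simp add: less_imp_le\<close>)
    then have "summable b" by simp
    then show False using divergent[OF q2] by (simp add: b_def x_def)
  qed
  then obtain J where J: "M \<le> (\<Sum>j\<in>{j\<^sub>0..<J}. b j)" by blast
  define I where "I = {j\<^sub>0..<J}"
  define B where "B = (\<Sum>j\<in>I. b j)"
  have BM: "M \<le> B" using J by (simp add: B_def I_def)
  then have B1: "1 \<le> B" using M1 by linarith
  define \<alpha> where "\<alpha> = (\<lambda>j. b j / B)"
  have I: "finite I" "\<And>j. j \<in> I \<Longrightarrow> j\<^sub>0 \<le> j" "\<And>j. j \<in> I \<Longrightarrow> j \<le> J" by (auto simp: I_def)
  have \<alpha>: "0 \<le> \<alpha> j" "\<alpha> j \<le> 1 / B" for j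
    using b[of j] B1 by (auto simp: \<alpha>_def divide_right_mono)
  have sum\<alpha>: "(\<Sum>j\<in>I. \<alpha> j) = 1"
    using B1 by (simp add: \<alpha>_def B_def flip: sum_divide_distrib)
  define G where "G = (\<lambda>z. \<Sum>j\<in>I. \<alpha> j * u j z)"
  have uc: "continuous_on unit_circle (u j)" if "j \<in> I" for j
    using u[OF I(2)[OF that]] by (simp add: bump_def)
  have Gc: "continuous_on unit_circle G"
    unfolding G_def by (intro continuous_intros uc)
  define \<delta> where "\<delta> = 1 / B"
  have \<delta>: "0 < \<delta>" using B1 by (simp add: \<delta>_def)
  have G_ge: "- \<delta> \<le> G z" if z: "z \<in> unit_circle" for z
    unfolding G_def \<delta>_def
    by (rule nested_bumps_sum[OF I(1) _ qR *(1) u[OF I(2)] \<alpha> _ z]) (use q2 B1 in auto)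
  have G_le: "G z \<le> 1" if z: "z \<in> unit_circle" for z
  proof -
    have "G z \<le> (\<Sum>j\<in>I. \<alpha> j * 1)"
      unfolding G_def using u[OF I(2)] z \<alpha>(1)
      by (intro sum_mono mult_left_mono) (auto simp: bump_def abs_le_iff)
    then show ?thesis using sum\<alpha> by simp
  qed
  have G_eq: "G z = 1" if z: "z \<in> unit_circle" "cmod (z - 1) \<le> \<rho> / real q ^ J" for z
  proof -
    have "u j z = 1" if j: "j \<in> I" for j
    proof -
      have "real q ^ j \<le> real q ^ J" using I(3)[OF j] q2 by (intro power_increasing) auto
      then have "\<rho> / real q ^ J \<le> \<rho> / real q ^ j" using *(1) qp by (intro divide_left_mono) (simp_all del: of_nat_power add: mult_pos_pos)
      then show ?thesis using u[OF I(2)[OF j]] z by (auto simp: bump_def)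
    qed
    then show ?thesis using sum\<alpha> by (simp add: G_def)
  qed
  have G_norm: "weighted_norm_le w (\<lambda>z. complex_of_real (G z)) (\<epsilon> / 2)"
  proof -
    have "(\<Sum>j\<in>I. (\<alpha> j)\<^sup>2 * (w (int (q ^ j)) / real q ^ j)) \<le> (\<Sum>j\<in>I. b j / B\<^sup>2)"
    proof (rule sum_mono)
      fix j
      have "(\<alpha> j)\<^sup>2 * (w (int (q ^ j)) / real q ^ j) = (b j / B\<^sup>2) * (b j * x j)"
        by (simp add: \<alpha>_def x_def power2_eq_square)
      also have "\<dots> \<le> b j / B\<^sup>2"
        using b[of j] by (intro mult_left_le) auto
      finally show "(\<alpha> j)\<^sup>2 * (w (int (q ^ j)) / real q ^ j) \<le> b j / B\<^sup>2" .
    qed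
    also have "\<dots> = 1 / B"
      using B1 by (simp add: B_def[symmetric] power2_eq_square flip: sum_divide_distrib)
    finally have "16 * K\<^sup>2 * L * (\<Sum>j\<in>I. (\<alpha> j)\<^sup>2 * (w (int (q ^ j)) / real q ^ j)) \<le> 16 * K\<^sup>2 * L * (1 / B)"
      using L_ge_1 by (intro mult_left_mono) auto
    also have "\<dots> \<le> (\<epsilon> / 2)\<^sup>2"
    proof -
      have "64 * K\<^sup>2 * L / \<epsilon>\<^sup>2 \<le> B" using MK BM by linarith
      then show ?thesis using B1 \<epsilon> by (simp add: field_simps power2_eq_square)
    qed
    finally have "sqrt (16 * K\<^sup>2 * L * (\<Sum>j\<in>I. (\<alpha> j)\<^sup>2 * (w (int (q ^ j)) / real q ^ j))) \<le> \<epsilon> / 2"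
      using \<epsilon> by (intro real_le_lsqrt) (auto intro!: sum_nonneg mult_nonneg_nonneg simp: pos less_imp_le L_ge_1)
    moreover have "weighted_norm_le w (\<lambda>z. complex_of_real (G z))
        (sqrt (16 * K\<^sup>2 * L * (\<Sum>j\<in>I. (\<alpha> j)\<^sup>2 * (w (int (q ^ j)) / real q ^ j))))"
      unfolding G_def by (rule weighted_norm_bumps_le[OF q2 I(1) *(3) \<alpha>(1) uc u1[OF I(2)] u2[OF I(2)]])
    ultimately show ?thesis
      unfolding weighted_norm_le_def by (meson order_trans)
  qed
  have G_decay: "cmod (fc G n) * real_of_int \<bar>n\<bar> ^ (a + 2) \<le> (\<Sum>j\<in>I. \<alpha> j * (K / real q ^ j * (real q ^ j) ^ (a + 2)))" for n
  proof -
    have "fc G n = (\<Sum>j\<in>I. \<alpha> j * fc (u j) n)"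
      unfolding G_def of_real_sum of_real_mult fourier_coeff_cmult[symmetric]
      by (rule fourier_coeff_sum) (intro continuous_intros uc)
    then have "cmod (fc G n) \<le> (\<Sum>j\<in>I. cmod (\<alpha> j * fc (u j) n))"
      by (simp add: norm_sum)
    also have "\<dots> = (\<Sum>j\<in>I. \<alpha> j * cmod (fc (u j) n))"
      using \<alpha>(1) by (simp add: norm_mult)
    finally have "cmod (fc G n) * real_of_int \<bar>n\<bar> ^ (a + 2)
        \<le> (\<Sum>j\<in>I. \<alpha> j * cmod (fc (u j) n)) * real_of_int \<bar>n\<bar> ^ (a + 2)"
      by (intro mult_right_mono) auto
    also have "\<dots> = (\<Sum>j\<in>I. \<alpha> j * (cmod (fc (u j) n) * real_of_int \<bar>n\<bar> ^ (a + 2)))"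
      unfolding sum_distrib_right mult.assoc ..
    also have "\<dots> \<le> (\<Sum>j\<in>I. \<alpha> j * (K / real q ^ j * (real q ^ j) ^ (a + 2)))"
      using u2 I(2) \<alpha>(1) by (intro sum_mono mult_left_mono) auto
    finally show ?thesis .
  qed
  \<comment> \<open>Adding \<delta> removes the negative values and the division restores the
    plateau value 1. Away from the point \<open>H\<close> is then a small positive constant instead
    of 0.\<close>
  define H where "H = (\<lambda>z. (G z + \<delta>) / (1 + \<delta>))"
  define s where "s = complex_of_real (1 / (1 + \<delta>))"
  have s: "cmod s \<le> 1" unfolding s_def norm_of_real using \<delta> by simp
  have H_eq: "(\<lambda>z. complex_of_real (H z)) = (\<lambda>z. s * (complex_of_real (G z) + complex_of_real \<delta>))"
    by (simp add: H_def s_def)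
  note Gcc = continuous_on_circle_of_real[OF Gc]
  show thesis
  proof
    show "\<rho> / real q ^ J > 0" using *(1) qp by simp
    show "continuous_on unit_circle H"
      unfolding H_def using \<delta> by (intro continuous_intros Gc) auto
    show "0 \<le> H z \<and> H z \<le> 1" if "z \<in> unit_circle" for z
      using G_ge[OF that] G_le[OF that] \<delta> by (simp add: H_def)
    show "H z = 1" if "z \<in> unit_circle" "cmod (z - 1) \<le> \<rho> / real q ^ J" for z
      using G_eq[OF that] \<delta> by (simp add: H_def)
    show "weighted_norm_le w (\<lambda>z. complex_of_real (H z)) \<epsilon>"
      unfolding weighted_norm_le_def
    proof (intro allI impI)
      fix F :: "int set" assume F: "finite F"
      have "weighted_norm w F (\<lambda>z. complex_of_real \<delta>) \<le> \<epsilon> / 2"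
      proof -
        have "weighted_norm w F (\<lambda>z. complex_of_real \<delta>) \<le> sqrt (w 0) * cmod (complex_of_real \<delta>)"
          by (rule weighted_norm_const_le[OF F])
        also have "\<dots> = sqrt (w 0) / B"
          unfolding norm_of_real using B1 by (simp add: \<delta>_def)
        also have "\<dots> \<le> \<epsilon> / 2"
        proof -
          have "2 * sqrt (w 0) / \<epsilon> \<le> B" using Mw BM by linarith
          then show ?thesis using B1 \<epsilon> by (simp add: field_simps)
        qed
        finally show ?thesis .
      qed
      moreover have "weighted_norm w F (\<lambda>z. complex_of_real (G z)) \<le> \<epsilon> / 2"
        using G_norm F by (simp add: weighted_norm_le_def)
      moreover have "weighted_norm w F (\<lambda>z. complex_of_real (G z) + complex_of_real \<delta>)
          \<le> weighted_norm w F (\<lambda>z. complex_of_real (G z)) + weighted_norm w F (\<lambda>z. complex_of_real \<delta>)"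
        by (rule weighted_norm_add[OF Gcc]) auto
      moreover have "weighted_norm w F (\<lambda>z. complex_of_real (H z))
          \<le> 1 * weighted_norm w F (\<lambda>z. complex_of_real (G z) + complex_of_real \<delta>)"
        unfolding H_eq weighted_norm_cmult using s weighted_norm_nonneg by (intro mult_right_mono)
      ultimately show "weighted_norm w F (\<lambda>z. complex_of_real (H z)) \<le> \<epsilon>" by linarith
    qed
    show "cmod (fc H n) * real_of_int \<bar>n\<bar> ^ (a + 2) \<le> (\<Sum>j\<in>I. \<alpha> j * (K / real q ^ j * (real q ^ j) ^ (a + 2)))" for n
    proof (cases "n = 0")
      case True
      then show ?thesis using *(3) \<alpha>(1) q2 by (auto intro!: sum_nonneg)
    next
      case False
      have "fc H n = s * fc G n"
        unfolding H_eq fourier_coeff_cmult using False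
        by (subst fourier_coeff_add) (auto intro: Gc simp: fourier_coeff_const)
      then have "cmod (fc H n) = cmod s * cmod (fc G n)" by (simp add: norm_mult)
      also have "\<dots> \<le> 1 * cmod (fc G n)" using s by (intro mult_right_mono) auto
      finally have "cmod (fc H n) * real_of_int \<bar>n\<bar> ^ (a + 2) \<le> cmod (fc G n) * real_of_int \<bar>n\<bar> ^ (a + 2)"
        by (intro mult_right_mono) auto
      then show ?thesis using G_decay[of n] by linarith
    qed
  qed
qed

subsection \<open>Multiplying the flat functions\<close>

text \<open>A flat function is rotated to x, giving h, and \<open>Q\<close> is multiplied by
  \<open>1 - h\<close>. The change \<open>Q * h\<close> has norm at most S times that of h, where S
  is the multiplier bound of \<open>Q\<close>; so the flat function is chosen after
  \<open>Q\<close>.\<close>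

lemma vanish_near_point:
  assumes Q: "continuous_on unit_circle Q" "multiplier w (\<lambda>z. complex_of_real (Q z))"
      "\<And>z. z \<in> unit_circle \<Longrightarrow> 0 \<le> Q z"
    and x: "x \<in> unit_circle" and \<eta>: "\<eta> > 0"
  obtains Q' \<rho> where "continuous_on unit_circle Q'" "multiplier w (\<lambda>z. complex_of_real (Q' z))"
    "\<And>z. z \<in> unit_circle \<Longrightarrow> 0 \<le> Q' z \<and> Q' z \<le> Q z"
    "\<rho> > 0" "\<And>z. z \<in> unit_circle \<Longrightarrow> cmod (z - x) \<le> \<rho> \<Longrightarrow> Q' z = 0"
    "weighted_norm_le w (\<lambda>z. complex_of_real (Q z) - complex_of_real (Q' z)) \<eta>"
proof -
  obtain S where S: "S \<ge> 0" "\<And>f E. continuous_on unit_circle f \<Longrightarrow> weighted_norm_le w f E \<Longrightarrow>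
      weighted_norm_le w (\<lambda>z. complex_of_real (Q z) * f z) (S * E)"
    using Q(2) unfolding multiplier_def by blast
  \<comment> \<open>The denominator \<open>S + 1\<close> also covers \<open>S = 0\<close>.\<close>
  have \<epsilon>: "\<eta> / (S + 1) > 0" using S(1) \<eta> by simp
  obtain H \<rho> B where H: "\<rho> > 0" "continuous_on unit_circle H"
    "\<And>z. z \<in> unit_circle \<Longrightarrow> 0 \<le> H z \<and> H z \<le> 1"
    "\<And>z. z \<in> unit_circle \<Longrightarrow> cmod (z - 1) \<le> \<rho> \<Longrightarrow> H z = 1"
    "weighted_norm_le w (\<lambda>z. complex_of_real (H z)) (\<eta> / (S + 1))"
    "\<And>n. cmod (fc H n) * real_of_int \<bar>n\<bar> ^ (a + 2) \<le> B"
    by (rule flat_function_exists[OF \<epsilon>]) (rule that)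
  obtain t where t: "x = cis t"
  proof
    show "x = cis (Arg2pi x)" using x Arg2pi_eq[of x] by (simp add: cis_conv_exp)
  qed
  define h where "h = (\<lambda>z. H (z * cis (- t)))"
  have hc: "continuous_on unit_circle h"
    unfolding h_def by (intro continuous_on_circle_rotate H)
  have mem: "z * cis (- t) \<in> unit_circle" if "z \<in> unit_circle" for z
    using that by (simp add: norm_mult)
  have h01: "0 \<le> h z" "h z \<le> 1" if "z \<in> unit_circle" for z
    using H(3)[OF mem[OF that]] by (simp_all add: h_def)
  have h1: "h z = 1" if z: "z \<in> unit_circle" "cmod (z - x) \<le> \<rho>" for z
  proof -
    have "z * cis (- t) - 1 = (z - x) * cis (- t)"
      unfolding t left_diff_distrib cis_mult by simp
    then have "cmod (z * cis (- t) - 1) = cmod (z - x)" by (simp add: norm_mult)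
    then show ?thesis using H(4)[OF mem[OF z(1)]] z(2) by (simp add: h_def)
  qed
  \<comment> \<open>Rotation changes coefficients only by unimodular factors, so both the weighted
    norm and the decay carry over.\<close>
  have fch: "cmod (fc h n) = cmod (fc H n)" for n
    unfolding h_def using fourier_coeff_rotate[OF continuous_on_circle_of_real[OF H(2)], of "- t" n]
    by (simp add: norm_mult)
  have hn: "weighted_norm_le w (\<lambda>z. complex_of_real (h z)) (\<eta> / (S + 1))"
    using H(5) by (simp add: weighted_norm_le_def weighted_norm_def fch)
  have hm: "multiplier w (\<lambda>z. 1 - complex_of_real (h z))"
  proof (rule multiplier_decay)
    show "continuous_on unit_circle (\<lambda>z. 1 - complex_of_real (h z))"
      by (intro continuous_intros hc)
    fix n :: int
    have B: "0 \<le> B" using H(6)[of 0] by simp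
    show "cmod (fourier_coeff (\<lambda>z. 1 - complex_of_real (h z)) n) * real_of_int \<bar>n\<bar> ^ (a + 2) \<le> B"
    proof (cases "n = 0")
      case False
      have "fourier_coeff (\<lambda>z. 1 - complex_of_real (h z)) n = - fc h n"
        using False by (subst fourier_coeff_diff) (simp_all add: fourier_coeff_const continuous_on_of_real hc)
      then show ?thesis using H(6)[of n] by (simp add: fch)
    qed (simp add: B)
  qed
  show thesis
  proof
    define Q' where "Q' = (\<lambda>z. Q z * (1 - h z))"
    show "continuous_on unit_circle Q'"
      unfolding Q'_def by (intro continuous_intros Q hc)
    show "multiplier w (\<lambda>z. complex_of_real (Q' z))"
      using multiplier_mult[OF Q(2) hm] by (simp add: Q'_def)
    show "0 \<le> Q' z \<and> Q' z \<le> Q z" if "z \<in> unit_circle" for z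
      using h01[OF that] Q(3)[OF that] by (simp add: Q'_def mult_left_le)
    show "Q' z = 0" if "z \<in> unit_circle" "cmod (z - x) \<le> \<rho>" for z
      using h1[OF that] by (simp add: Q'_def)
    show "weighted_norm_le w (\<lambda>z. complex_of_real (Q z) - complex_of_real (Q' z)) \<eta>"
    proof -
      have "weighted_norm_le w (\<lambda>z. complex_of_real (Q z) * complex_of_real (h z)) (S * (\<eta> / (S + 1)))"
        by (rule S(2)[OF continuous_on_circle_of_real[OF hc] hn])
      moreover have "S * (\<eta> / (S + 1)) \<le> \<eta>"
        using S(1) \<eta> by (simp add: field_simps)
      moreover have "(\<lambda>z. complex_of_real (Q z) - complex_of_real (Q' z))
          = (\<lambda>z. complex_of_real (Q z) * complex_of_real (h z))"
        by (simp add: Q'_def algebra_simps)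
      ultimately show ?thesis
        unfolding weighted_norm_le_def by fastforce
    qed
  qed (rule H(1))
qed

text \<open>Step n vanishes around \<open>x n\<close> with tolerance \<eta>/2^n, and the tolerances
  add up to 2\<eta>. Being a multiplier is carried along as an invariant, because the next step
  needs it.\<close>

lemma vanishing_sequence:
  assumes x: "\<And>n. x n \<in> unit_circle" and \<eta>: "\<eta> > 0"
  obtains Q \<rho> where "\<And>n. continuous_on unit_circle (Q n)"
    "\<And>n z. z \<in> unit_circle \<Longrightarrow> 0 \<le> Q n z \<and> Q n z \<le> 1"
    "\<And>n z. z \<in> unit_circle \<Longrightarrow> Q (Suc n) z \<le> Q n z"
    "\<And>n. \<rho> n > 0" "\<And>n z. z \<in> unit_circle \<Longrightarrow> cmod (z - x n) \<le> \<rho> n \<Longrightarrow> Q (Suc n) z = 0"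
    "\<And>n. weighted_norm_le w (\<lambda>z. 1 - complex_of_real (Q n z)) (2 * \<eta>)"
proof -
  \<comment> \<open>The last conjunct pins the start of the sequence to the constant 1, which the
    dependent choice would otherwise leave open.\<close>
  define P where "P = (\<lambda>(n::nat) Q. continuous_on unit_circle Q \<and> multiplier w (\<lambda>z. complex_of_real (Q z)) \<and>
    (\<forall>z\<in>unit_circle. 0 \<le> Q z) \<and> (n = 0 \<longrightarrow> Q = (\<lambda>_. 1)))"
  define R where "R = (\<lambda>n Q Q'. (\<forall>z\<in>unit_circle. Q' z \<le> Q z) \<and>
    (\<exists>\<rho>>0. \<forall>z\<in>unit_circle. cmod (z - x n) \<le> \<rho> \<longrightarrow> Q' z = 0) \<and>
    weighted_norm_le w (\<lambda>z. complex_of_real (Q z) - complex_of_real (Q' z)) (\<eta> * (1 / 2) ^ n))"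
  have "\<exists>Q. \<forall>n. P n (Q n) \<and> R n (Q n) (Q (Suc n))"
  proof (rule dependent_nat_choice)
    show "\<exists>Q. P 0 Q"
      by (rule exI[of _ "\<lambda>_. 1"]) (simp add: P_def multiplier_1)
    fix Q n assume Q: "P n Q"
    then have Q': "continuous_on unit_circle Q" "multiplier w (\<lambda>z. complex_of_real (Q z))"
      "\<And>z. z \<in> unit_circle \<Longrightarrow> 0 \<le> Q z"
      by (simp_all add: P_def)
    have \<eta>n: "\<eta> * (1 / 2) ^ n > 0" using \<eta> by simp
    obtain Q2 \<rho> where "continuous_on unit_circle Q2" "multiplier w (\<lambda>z. complex_of_real (Q2 z))"
      "\<And>z. z \<in> unit_circle \<Longrightarrow> 0 \<le> Q2 z \<and> Q2 z \<le> Q z"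
      "\<rho> > 0" "\<And>z. z \<in> unit_circle \<Longrightarrow> cmod (z - x n) \<le> \<rho> \<Longrightarrow> Q2 z = 0"
      "weighted_norm_le w (\<lambda>z. complex_of_real (Q z) - complex_of_real (Q2 z)) (\<eta> * (1 / 2) ^ n)"
      by (rule vanish_near_point[OF Q'(1,2) _ x[of n] \<eta>n]) (rule Q'(3), assumption, rule that)
    then show "\<exists>Q2. P (Suc n) Q2 \<and> R n Q Q2"
      unfolding P_def R_def by (intro exI[of _ Q2] conjI exI[of _ \<rho>]) simp_all
  qed
  then obtain Q where PQ: "\<And>n. P n (Q n)" and RQ: "\<And>n. R n (Q n) (Q (Suc n))" by blast
  have "\<exists>\<rho>. \<forall>n. \<rho> n > 0 \<and> (\<forall>z\<in>unit_circle. cmod (z - x n) \<le> \<rho> n \<longrightarrow> Q (Suc n) z = 0)"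
    using RQ unfolding R_def by (intro choice) blast
  then obtain \<rho> where \<rho>: "\<And>n. \<rho> n > 0" "\<And>n z. z \<in> unit_circle \<Longrightarrow> cmod (z - x n) \<le> \<rho> n \<Longrightarrow> Q (Suc n) z = 0"
    by blast
  have Qc: "continuous_on unit_circle (Q n)" for n
    using PQ[of n] by (simp add: P_def)
  have Q0: "Q 0 = (\<lambda>_. 1)" using PQ[of 0] by (simp add: P_def)
  have dec: "Q (Suc n) z \<le> Q n z" if "z \<in> unit_circle" for n z
    using RQ[of n] that by (simp add: R_def)
  have le1: "Q n z \<le> 1" if "z \<in> unit_circle" for n z
  proof (induction n)
    case (Suc n)
    then show ?case using dec[OF that, of n] by linarith
  qed (simp add: Q0)
  have norm: "weighted_norm w F (\<lambda>z. 1 - complex_of_real (Q n z)) \<le> 2 * \<eta> * (1 - (1 / 2) ^ n)"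
    if F: "finite F" for F n
  proof (induction n)
    case 0
    then show ?case using weighted_norm_const_le[OF F, of 0] by (simp add: Q0)
  next
    case (Suc n)
    have "weighted_norm w F (\<lambda>z. 1 - complex_of_real (Q (Suc n) z))
        = weighted_norm w F (\<lambda>z. (1 - complex_of_real (Q n z)) + (complex_of_real (Q n z) - complex_of_real (Q (Suc n) z)))"
      by simp
    also have "\<dots> \<le> weighted_norm w F (\<lambda>z. 1 - complex_of_real (Q n z))
        + weighted_norm w F (\<lambda>z. complex_of_real (Q n z) - complex_of_real (Q (Suc n) z))"
      by (rule weighted_norm_add) (intro continuous_intros Qc)+
    also have "weighted_norm w F (\<lambda>z. complex_of_real (Q n z) - complex_of_real (Q (Suc n) z)) \<le> \<eta> * (1 / 2) ^ n"
      using RQ[of n] F by (simp add: R_def weighted_norm_le_def)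
    finally show ?case using Suc.IH by (simp add: algebra_simps)
  qed
  show thesis
  proof (rule that[of Q \<rho>])
    show "0 \<le> Q n z \<and> Q n z \<le> 1" if "z \<in> unit_circle" for n z
      using PQ[of n] le1[OF that, of n] that by (simp add: P_def)
    show "weighted_norm_le w (\<lambda>z. 1 - complex_of_real (Q n z)) (2 * \<eta>)" for n
      unfolding weighted_norm_le_def
    proof (intro allI impI)
      fix F :: "int set" assume F: "finite F"
      have "2 * \<eta> * (1 - (1 / 2) ^ n) \<le> 2 * \<eta>" using \<eta> by simp
      then show "weighted_norm w F (\<lambda>z. 1 - complex_of_real (Q n z)) \<le> 2 * \<eta>"
        using norm[OF F, of n] by linarith
    qed
  qed (use Qc dec \<rho> in auto)
qed

section \<open>The limit function\<close>

text \<open>The decreasing sequence has a pointwise limit g, which vanishes near each point of a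
  dense set since g lies below every later stage. Coefficientwise convergence passes on the norm
  bounds; taken at frequency 0 alone, they keep the mean of f away from 0.\<close>

theorem nowhere_dense_support_exists:
  "\<exists>f \<in> Linfty circle_measure.
     (AE z in circle_measure. f z \<in> \<real>\<^sub>\<ge>\<^sub>0) \<and>
     \<not> (AE z in circle_measure. f z = 0) \<and>
     (top_of_set unit_circle) interior_of (circle_support f) = {} \<and>
     (\<lambda>n. (cmod (fourier_coeff f n))\<^sup>2 * w n) summable_on UNIV"
proof -
  obtain D where D: "countable D" "D \<subseteq> unit_circle" "unit_circle \<subseteq> closure D"
    by (rule separable[of unit_circle])
  have "1 \<in> closure D" using D(3) by auto
  then have "D \<noteq> {}" by auto
  define x where "x = from_nat_into D"
  have rx: "range x = D" unfolding x_def by (rule range_from_nat_into[OF \<open>D \<noteq> {}\<close> D(1)])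
  then have x: "x n \<in> unit_circle" for n using D(2) by blast
  \<comment> \<open>With this value the bound 2\<eta> on sqrt(w 0) |1 - mean of f| gives |1 - mean
    of f| <= 1/2.\<close>
  define \<eta> where "\<eta> = sqrt (w 0) / 4"
  have \<eta>: "\<eta> > 0" using pos by (simp add: \<eta>_def)
  obtain Q \<rho> where Qc: "\<And>n. continuous_on unit_circle (Q n)"
    and Q01: "\<And>n z. z \<in> unit_circle \<Longrightarrow> 0 \<le> Q n z \<and> Q n z \<le> 1"
    and dec: "\<And>n z. z \<in> unit_circle \<Longrightarrow> Q (Suc n) z \<le> Q n z"
    and \<rho>: "\<And>n. \<rho> n > 0" and Q_zero: "\<And>n z. z \<in> unit_circle \<Longrightarrow> cmod (z - x n) \<le> \<rho> n \<Longrightarrow> Q (Suc n) z = 0"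
    and Qn: "\<And>n. weighted_norm_le w (\<lambda>z. 1 - complex_of_real (Q n z)) (2 * \<eta>)"
    by (rule vanishing_sequence[of x \<eta>, OF x \<eta>]) (rule that)
  define g where "g = (\<lambda>z. lim (\<lambda>n. Q n z))"
  have decs: "decseq (\<lambda>n. Q n z)" if "z \<in> unit_circle" for z
    using dec[OF that] by (rule decseq_SucI)
  have lim: "(\<lambda>n. Q n z) \<longlonglongrightarrow> g z" if z: "z \<in> unit_circle" for z
  proof -
    obtain l where "(\<lambda>n. Q n z) \<longlonglongrightarrow> l"
      using decseq_convergent[OF decs[OF z], of 0] Q01[OF z] by blast
    then have "convergent (\<lambda>n. Q n z)" by (rule convergentI)
    then show ?thesis unfolding g_def by (rule convergent_LIMSEQ_iff[THEN iffD1])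
  qed
  have g01: "0 \<le> g z" "g z \<le> 1" if z: "z \<in> unit_circle" for z
    using LIMSEQ_le_const[OF lim[OF z], of 0] LIMSEQ_le_const2[OF lim[OF z], of 1] Q01[OF z] by auto
  have g_le: "g z \<le> Q n z" if z: "z \<in> unit_circle" for z n
    using decseq_ge[OF decs[OF z] lim[OF z]] .
  define f where "f = (\<lambda>z. complex_of_real (g z))"
  have Qcc: "continuous_on unit_circle (\<lambda>z. complex_of_real (Q n z))" for n
    by (rule continuous_on_circle_of_real[OF Qc])
  have limc: "(\<lambda>n. complex_of_real (Q n z)) \<longlonglongrightarrow> f z" if "z \<in> unit_circle" for z
    unfolding f_def by (intro tendsto_of_real lim that)
  have fcQ: "(\<lambda>k. fc (Q k) n) \<longlonglongrightarrow> fourier_coeff f n" for n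
    by (rule fourier_coeff_tendsto[where B=1]) (use Qcc Q01 limc in auto)
  have meas: "f \<in> borel_measurable circle_measure"
    by (rule borel_measurable_LIMSEQ_metric[where f="\<lambda>n z. complex_of_real (Q n z)"])
       (use borel_measurable_circle_continuous[OF Qcc] limc in auto)
  have Linf: "f \<in> Linfty circle_measure"
    unfolding Linfty_def
  proof (intro CollectI conjI exI[of _ 1])
    show "AE z in circle_measure. norm (f z) \<le> 1"
      by (rule AE_circle_space) (use g01 in \<open>simp add: f_def\<close>)
  qed (rule meas)
  have fpos: "AE z in circle_measure. f z \<in> \<real>\<^sub>\<ge>\<^sub>0"
    by (rule AE_circle_space) (use g01 in \<open>simp add: f_def\<close>)
  have f0: "fourier_coeff f 0 \<noteq> 0"
  proof
    assume 0: "fourier_coeff f 0 = 0"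
    have "(\<lambda>k. sqrt (w 0) * cmod (1 - fc (Q k) 0)) \<longlonglongrightarrow> sqrt (w 0) * cmod (1 - fourier_coeff f 0)"
      by (intro tendsto_intros fcQ)
    moreover have "sqrt (w 0) * cmod (1 - fc (Q k) 0) \<le> 2 * \<eta>" for k
    proof -
      have "fourier_coeff (\<lambda>z. 1 - complex_of_real (Q k z)) 0 = 1 - fc (Q k) 0"
        by (subst fourier_coeff_diff) (simp_all add: Qc continuous_on_circle_of_real fourier_coeff_const)
      moreover have "weighted_norm w {0} (\<lambda>z. 1 - complex_of_real (Q k z)) \<le> 2 * \<eta>"
        using Qn[of k] by (simp add: weighted_norm_le_def)
      ultimately show ?thesis
        using pos[of 0] by (simp add: weighted_norm_def L2_set_def real_sqrt_mult abs_mult)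
    qed
    ultimately have "sqrt (w 0) * cmod (1 - fourier_coeff f 0) \<le> 2 * \<eta>"
      by (intro LIMSEQ_le_const2) auto
    then show False using 0 pos[of 0] by (simp add: \<eta>_def)
  qed
  have f_nonzero: "\<not> (AE z in circle_measure. f z = 0)"
  proof
    assume "AE z in circle_measure. f z = 0"
    then have "AE z in circle_measure. f z * cnj z powi 0 = 0" by simp
    then have "fourier_coeff f 0 = 0"
      unfolding fourier_coeff_def by (rule integral_eq_zero_AE)
    then show False using f0 by contradiction
  qed
  have x_off: "x n \<notin> circle_support f" for n
  proof -
    define U where "U = unit_circle \<inter> ball (x n) (\<rho> n)"
    have "openin (top_of_set unit_circle) U"
      unfolding U_def by (rule openin_open_Int) simp
    moreover have "AE z in circle_measure. z \<in> U \<longrightarrow> f z = 0"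
    proof (rule AE_circle_space, rule impI)
      fix z assume z: "z \<in> unit_circle" "z \<in> U"
      then have "cmod (z - x n) \<le> \<rho> n" by (simp add: U_def dist_norm norm_minus_commute)
      then have "g z \<le> 0" using Q_zero[OF z(1)] g_le[OF z(1), of "Suc n"] by simp
      then show "f z = 0" using g01[OF z(1)] by (simp add: f_def)
    qed
    moreover have "x n \<in> U" using x \<rho> by (simp add: U_def)
    ultimately show ?thesis unfolding circle_support_def by blast
  qed
  have int: "(top_of_set unit_circle) interior_of (circle_support f) = {}"
  proof (rule ccontr)
    assume ne: "(top_of_set unit_circle) interior_of (circle_support f) \<noteq> {}"
    have "openin (top_of_set unit_circle) ((top_of_set unit_circle) interior_of (circle_support f))"
      by (rule openin_interior_of)
    then obtain V where V: "open V" "(top_of_set unit_circle) interior_of (circle_support f) = unit_circle \<inter> V"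
      unfolding openin_open by blast
    \<comment> \<open>A nonempty relatively open set meets the dense sequence, whose members all lie
      off the support.\<close>
    then have "V \<inter> closure D \<noteq> {}" using ne D(3) by blast
    then have "V \<inter> D \<noteq> {}" using open_Int_closure_eq_empty[OF V(1)] by blast
    then obtain n where "x n \<in> V" using rx by blast
    then have "x n \<in> (top_of_set unit_circle) interior_of (circle_support f)"
      using V(2) x by blast
    then show False using x_off interior_of_subset[of "top_of_set unit_circle" "circle_support f"] by blast
  qed
  have summ: "(\<lambda>n. (cmod (fourier_coeff f n))\<^sup>2 * w n) summable_on UNIV"
  proof (rule nonneg_bounded_partial_sums_imp_summable_on)
    define E where "E = sqrt (w 0) + 2 * \<eta>"
    have "weighted_norm w F f \<le> E" if F: "finite F" for F
    proof (rule weighted_norm_tendsto_le[OF _ fcQ])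
      fix k
      have c: "continuous_on unit_circle (\<lambda>z. 1 - complex_of_real (Q k z))"
        by (intro continuous_intros Qc)
      have "weighted_norm w F (\<lambda>z. complex_of_real (Q k z))
          = weighted_norm w F (\<lambda>z. 1 + (- 1) * (1 - complex_of_real (Q k z)))"
        by simp
      also have "\<dots> \<le> weighted_norm w F (\<lambda>z. 1) + weighted_norm w F (\<lambda>z. (- 1) * (1 - complex_of_real (Q k z)))"
        by (rule weighted_norm_add) (intro continuous_intros Qc)+
      also have "\<dots> = weighted_norm w F (\<lambda>z. 1) + weighted_norm w F (\<lambda>z. 1 - complex_of_real (Q k z))"
        unfolding weighted_norm_cmult by simp
      also have "\<dots> \<le> sqrt (w 0) * cmod 1 + 2 * \<eta>"
        using Qn[of k] F by (intro add_mono weighted_norm_const_le) (auto simp: weighted_norm_le_def)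
      finally show "weighted_norm w F (\<lambda>z. complex_of_real (Q k z)) \<le> E"
        by (simp add: E_def)
    qed
    then have "(\<Sum>n\<in>F. (cmod (fourier_coeff f n))\<^sup>2 * w n) \<le> E\<^sup>2" if F: "finite F" for F
    proof -
      have "(\<Sum>n\<in>F. (cmod (fourier_coeff f n))\<^sup>2 * w n) = (weighted_norm w F f)\<^sup>2"
        unfolding weighted_norm_def L2_set_def using pos
        by (subst real_sqrt_pow2) (auto intro!: sum_nonneg simp: power_mult_distrib less_imp_le mult.commute)
      also have "\<dots> \<le> E\<^sup>2"
        using \<open>\<And>F. finite F \<Longrightarrow> weighted_norm w F f \<le> E\<close>[OF F] weighted_norm_nonneg by (intro power_mono)
      finally show ?thesis .
    qed
    then show "\<forall>\<^sub>F F in finite_subsets_at_top UNIV. (\<Sum>n\<in>F. (cmod (fourier_coeff f n))\<^sup>2 * w n) \<le> E\<^sup>2"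
      by (intro eventually_finite_subsets_at_top_weakI) simp
  qed (use pos in \<open>simp add: less_imp_le\<close>)
  show ?thesis
    by (intro bexI[OF _ Linf] conjI fpos f_nonzero int summ)
qed

end

section \<open>From the given sequence to the abstract weight\<close>

text \<open>Cauchy condensation in base q, with the power bound in place of monotonicity: on the
  block from q^j to q^(j+1) each term is at most C q^a/lam(q^j), and the block has at most q^(j+1)
  terms.\<close>

lemma divergent_geometric:
  fixes lam :: "nat \<Rightarrow> real"
  assumes pos: "\<And>n. lam n > 0" and C: "C \<ge> 0"
    and bound: "\<And>m n. 1 \<le> n \<Longrightarrow> n \<le> m \<Longrightarrow> lam n \<le> C * (real m / n) ^ a * lam m"
    and div: "\<not> summable (\<lambda>n. 1 / lam n)" and q: "2 \<le> (q::nat)"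
  shows "\<not> summable (\<lambda>j. 1 / (1 + lam (q ^ j) / real (q ^ j)))"
proof
  assume summ: "summable (\<lambda>j. 1 / (1 + lam (q ^ j) / real (q ^ j)))"
  define T where "T = (\<lambda>j. real q ^ j)"
  have T: "T j > 0" for j using q by (simp add: T_def)
  have "(\<lambda>j. 1 / (1 + lam (q ^ j) / T j)) \<longlonglongrightarrow> 0"
    using summable_LIMSEQ_zero[OF summ] by (simp add: T_def)
  then have "\<forall>\<^sub>F j in sequentially. 1 / (1 + lam (q ^ j) / T j) < 1 / 2"
    by (rule order_tendstoD) simp
  \<comment> \<open>The cap in the summand is invisible in the end: terms tending to 0 force the
    ratio y above 1, where 1/y <= 2/(1 + y).\<close>
  then have ev: "\<forall>\<^sub>F j in sequentially. norm (T j / lam (q ^ j)) \<le> 2 * (1 / (1 + lam (q ^ j) / T j))"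
  proof eventually_elim
    case (elim j)
    define y where "y = lam (q ^ j) / T j"
    have y: "y > 0" using pos T by (simp add: y_def)
    have "1 / (1 + y) < 1 / 2" using elim by (simp add: y_def)
    then have "y > 1" using y by (simp add: field_simps)
    then have "1 / y \<le> 2 * (1 / (1 + y))" by (simp add: divide_simps)
    moreover have "norm (T j / lam (q ^ j)) = 1 / y"
      using pos[of "q ^ j"] T[of j] by (simp add: y_def)
    ultimately show ?case by (simp add: y_def)
  qed
  have "summable (\<lambda>j. 2 * (1 / (1 + lam (q ^ j) / T j)))"
    using summable_mult[OF summ, of 2] by (simp add: T_def)
  then have sT: "summable (\<lambda>j. T j / lam (q ^ j))"
    using ev by (rule summable_comparison_test_ev[rotated])
  define A where "A = 1 / lam 0 + C * real q ^ (a + 1) * (\<Sum>j. T j / lam (q ^ j))"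
  have block: "(\<Sum>n\<in>{q ^ j..<q ^ Suc j}. 1 / lam n) \<le> C * real q ^ (a + 1) * (T j / lam (q ^ j))" for j
  proof -
    have "1 / lam n \<le> C * real q ^ a / lam (q ^ j)" if n: "n \<in> {q ^ j..<q ^ Suc j}" for n
    proof -
      have "1 \<le> q ^ j" using q by simp
      then have "lam (q ^ j) \<le> C * (real n / real (q ^ j)) ^ a * lam n"
        using bound[of "q ^ j" n] n by simp
      also have "\<dots> \<le> C * real q ^ a * lam n"
      proof (intro mult_right_mono mult_left_mono power_mono)
        have "real n \<le> real (q ^ Suc j)" unfolding of_nat_le_iff using n by simp
        then show "real n / real (q ^ j) \<le> real q" using q by (simp add: divide_le_eq)
      qed (use C pos[of n] in auto)
      finally show ?thesis using pos[of n] pos[of "q ^ j"] by (simp add: field_simps)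
    qed
    then have "(\<Sum>n\<in>{q ^ j..<q ^ Suc j}. 1 / lam n) \<le> real (card {q ^ j..<q ^ Suc j}) * (C * real q ^ a / lam (q ^ j))"
      by (intro sum_bounded_above) auto
    also have "\<dots> \<le> real (q ^ Suc j) * (C * real q ^ a / lam (q ^ j))"
    proof (rule mult_right_mono)
      show "real (card {q ^ j..<q ^ Suc j}) \<le> real (q ^ Suc j)"
        unfolding of_nat_le_iff by simp
    qed (use C pos[of "q ^ j"] in simp)
    also have "\<dots> = C * real q ^ (a + 1) * (T j / lam (q ^ j))"
      by (simp add: T_def)
    finally show ?thesis .
  qed
  have part: "(\<Sum>n<q ^ J. 1 / lam n) \<le> 1 / lam 0 + C * real q ^ (a + 1) * (\<Sum>j<J. T j / lam (q ^ j))" for J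
  proof (induction J)
    case (Suc J)
    have "(\<Sum>n<q ^ Suc J. 1 / lam n) = (\<Sum>n<q ^ J. 1 / lam n) + (\<Sum>n\<in>{q ^ J..<q ^ Suc J}. 1 / lam n)"
      unfolding lessThan_atLeast0 using q by (intro sum.atLeastLessThan_concat[symmetric]) auto
    then show ?case using Suc block[of J] by (simp add: distrib_left)
  qed simp
  have "summable (\<lambda>n. 1 / lam n)"
  proof (rule bounded_imp_summable[where B=A])
    fix N
    have "N < q ^ N" by (rule less_le_trans[OF less_exp power_mono[OF q]]) simp
    then have "(\<Sum>n\<le>N. 1 / lam n) \<le> (\<Sum>n<q ^ N. 1 / lam n)"
      using pos by (intro sum_mono2) (auto simp: less_imp_le)
    also have "\<dots> \<le> A"
    proof -
      have "(\<Sum>j<N. T j / lam (q ^ j)) \<le> (\<Sum>j. T j / lam (q ^ j))"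
        using pos T by (intro sum_le_suminf sT) (auto simp: less_imp_le)
      then have "C * real q ^ (a + 1) * (\<Sum>j<N. T j / lam (q ^ j))
          \<le> C * real q ^ (a + 1) * (\<Sum>j. T j / lam (q ^ j))"
        using C by (intro mult_left_mono) auto
      then show ?thesis using order_trans[OF part[of N]] by (simp only: A_def add_left_mono)
    qed
    finally show "(\<Sum>n\<le>N. 1 / lam n) \<le> A" .
  qed (use pos in \<open>simp add: less_imp_le\<close>)
  then show False using div by contradiction
qed

text \<open>It remains to see that n -> lam |n| is a \<open>slow_weight\<close>: the power bounds
  give moderation and scaling, condensation gives divergence.\<close>

theorem theorem1p3:
  fixes lam :: "nat \<Rightarrow> real"
  assumes pos: "\<And>n. lam n > 0"
    and diverges: "(\<Sum>n. ereal (1 / lam n)) = \<infinity>"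
    and doubling: "\<exists>C>1. \<forall>n\<ge>1. \<forall>k. n \<le> k \<and> k \<le> 2 * n \<longrightarrow>
                     inverse C * lam n \<le> lam k \<and> lam k \<le> C * lam n"
  shows "\<exists>f \<in> Linfty circle_measure.
           (AE z in circle_measure. f z \<in> \<real>\<^sub>\<ge>\<^sub>0) \<and>
           \<not> (AE z in circle_measure. f z = 0) \<and>
           (top_of_set unit_circle) interior_of (circle_support f) = {} \<and>
           (\<lambda>n::int. (cmod (fourier_coeff f n))\<^sup>2 * lam (nat \<bar>n\<bar>)) summable_on UNIV"
proof -
  obtain C where C: "C > 1" and dbl: "\<And>n k. n \<ge> 1 \<Longrightarrow> n \<le> k \<Longrightarrow> k \<le> 2 * n \<Longrightarrow>
      inverse C * lam n \<le> lam k \<and> lam k \<le> C * lam n"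
    using doubling by blast
  obtain a where a: "\<And>m n. 1 \<le> n \<Longrightarrow> n \<le> m \<Longrightarrow>
      lam m \<le> C * (real m / n) ^ a * lam n \<and> lam n \<le> C * (real m / n) ^ a * lam m"
    by (rule doubling_power_bound[OF pos C dbl]) auto
  define w where "w = (\<lambda>n::int. lam (nat \<bar>n\<bar>))"
  \<comment> \<open>The doubling condition says nothing about index 0, so \<open>lam 0\<close> is
    compared with \<open>lam 1\<close> by hand. \<open>M\<close> enters \<open>L\<close> squared
    because either of the two indices compared may be 0.\<close>
  define M where "M = max 1 (max (lam 1 / lam 0) (lam 0 / lam 1))"
  define L where "L = C * M\<^sup>2"
  have M1: "M \<ge> 1" by (simp add: M_def)
  have CL: "C \<le> L" using C M1 one_le_power[OF M1, of 2] by (simp add: L_def)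
  have M: "lam k \<le> M * lam (max 1 k)" "lam (max 1 k) \<le> M * lam k" for k
  proof -
    have "lam 1 / lam 0 \<le> M" "lam 0 / lam 1 \<le> M" by (simp_all add: M_def)
    then have "lam 0 \<le> M * lam 1" "lam 1 \<le> M * lam 0"
      using pos by (simp_all add: pos_divide_le_eq)
    moreover have "lam k \<le> M * lam k" using M1 pos[of k] by simp
    ultimately show "lam k \<le> M * lam (max 1 k)" "lam (max 1 k) \<le> M * lam k"
      by (cases k; simp)+
  qed
  interpret slow_weight w L a
  proof unfold_locales
    show "w n > 0" for n using pos by (simp add: w_def)
    show "w m \<le> L * (1 + real_of_int \<bar>m - n\<bar>) ^ a * w n" for m n
    proof -
      define p q where "p = max 1 (nat \<bar>m\<bar>)" and "q = max 1 (nat \<bar>n\<bar>)"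
      define d where "d = real_of_int \<bar>m - n\<bar>"
      have pq: "1 \<le> p" "1 \<le> q" by (simp_all add: p_def q_def)
      have d: "d \<ge> 0" "real p \<le> q + d" "real q \<le> p + d"
        by (simp_all add: d_def p_def q_def)
      \<comment> \<open>A difference of at most d becomes a quotient of at most 1 + d because the
        denominator is at least 1.\<close>
      have ratio: "real i / j \<le> 1 + d" if "real i \<le> j + d" "1 \<le> j" for i j :: nat
      proof -
        have "1 * d \<le> real j * d" using that d(1) by (intro mult_right_mono) auto
        then have "real i \<le> real j * (1 + d)" using that(1) by (simp add: distrib_left)
        then show ?thesis using that(2) by (simp add: divide_le_eq mult.commute)
      qed
      have "lam p \<le> C * (1 + d) ^ a * lam q"
      proof (cases "q \<le> p")
        case True
        have "C * (real p / q) ^ a * lam q \<le> C * (1 + d) ^ a * lam q"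
          using C pos[of q] ratio[OF d(2) pq(2)]
          by (intro mult_right_mono mult_left_mono power_mono) auto
        then show ?thesis using a[OF pq(2) True] by linarith
      next
        case False
        then have le: "p \<le> q" by simp
        have "C * (real q / p) ^ a * lam q \<le> C * (1 + d) ^ a * lam q"
          using C pos[of q] ratio[OF d(3) pq(1)]
          by (intro mult_right_mono mult_left_mono power_mono) auto
        then show ?thesis using a[OF pq(1) le] by linarith
      qed
      also have "\<dots> \<le> C * (1 + d) ^ a * (M * w n)"
        using M(2) C d(1) by (intro mult_left_mono) (auto simp: q_def w_def)
      finally have "M * lam p \<le> M * (C * (1 + d) ^ a * (M * w n))"
        using M1 by (intro mult_left_mono) auto
      moreover have "w m \<le> M * lam p" using M(1) by (simp add: p_def w_def)
      ultimately show ?thesis by (simp add: L_def d_def power2_eq_square mult_ac)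
    qed
    show "w n * (min (real_of_int \<bar>n\<bar> / real T) (real T / real_of_int \<bar>n\<bar>)) ^ a \<le> L * w (int T)"
      if n: "n \<noteq> 0" and T: "1 \<le> T" for n T
    proof -
      define p where "p = nat \<bar>n\<bar>"
      have p: "1 \<le> p" "real_of_int \<bar>n\<bar> = real p" using n by (simp_all add: p_def)
      define \<kappa> where "\<kappa> = min (real p / T) (T / real p)"
      have \<kappa>: "0 \<le> \<kappa>" by (simp add: \<kappa>_def)
      \<comment> \<open>Here x is the larger of p and T divided by the smaller, and \<kappa> = 1/x
        exactly cancels the power of x in the growth bound.\<close>
      have *: "lam p * \<kappa> ^ a \<le> C * lam T" if x: "lam p \<le> C * x ^ a * lam T" "x > 0" "\<kappa> \<le> 1 / x" for x :: real
      proof -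
        have "lam p * \<kappa> ^ a \<le> (C * x ^ a * lam T) * (1 / x) ^ a"
          using x \<kappa> pos[of p] pos[of T] C by (intro mult_mono power_mono) auto
        then show ?thesis using x(2) by (simp add: power_one_over)
      qed
      have "lam p * \<kappa> ^ a \<le> C * lam T"
      proof (cases "T \<le> p")
        case True
        then show ?thesis using a[OF T True] T p(1) by (intro *[of "real p / T"]) (auto simp: \<kappa>_def)
      next
        case False
        then have "p \<le> T" by simp
        then show ?thesis using a[OF p(1) \<open>p \<le> T\<close>] T p(1) by (intro *[of "real T / p"]) (auto simp: \<kappa>_def)
      qed
      also have "\<dots> \<le> L * lam T" using CL pos[of T] by (intro mult_right_mono) auto
      finally show ?thesis unfolding p(2) by (simp add: \<kappa>_def w_def p_def)
    qed
    show "\<not> summable (\<lambda>j. 1 / (1 + w (int (q ^ j)) / real (q ^ j)))" if "2 \<le> q" for q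
    proof -
      have "\<not> summable (\<lambda>n. 1 / lam n)"
        using diverges suminf_ereal_finite[of "\<lambda>n. 1 / lam n"] by blast
      then have "\<not> summable (\<lambda>j. 1 / (1 + lam (q ^ j) / real (q ^ j)))"
        by (intro divergent_geometric[where C=C and a=a] pos that) (use C a in auto)
      moreover have "w (int k) = lam k" for k by (simp add: w_def)
      ultimately show ?thesis by (simp only: not_False_eq_True)
    qed
  qed
  show ?thesis
    using nowhere_dense_support_exists unfolding w_def .
qed

end
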